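(* Let $0<\eta<2$ and, for every $n$, let $p=n^{-1-\eta}$ and $\mathcal{Y}\sim Y(n,p)$. Then asymptotically almost surely (with probability tending to $1$ as $n\to\infty$), $\frac{\eta}{2}\le h_1(\mathcal{Y},\mathrm{Sym})\le\frac{9\eta}{4}+3$.
   Context: Random model: $\mathcal{Y}\sim Y(n,p)$ is the random $2$-dimensional (Linial--Meshulam) simplicial complex with vertex set $[n]=\{1,\dots,n\}$, containing all $\binom n2$ edges, in which each of the $\binom n3$ triangles is included independently with probability $p$. Cochains with permutation coefficients: let $\mathcal{Y}$ be a finite $2$-dimensional simplicial complex. A $1$-cochain with $\mathrm{Sym}(N)$ coefficients is a function $\alpha$ from the oriented edges of $\mathcal{Y}$ to $\mathrm{Sym}(N)$ with $\alpha(yx)=\alpha(xy)^{-1}$. Its coboundary is defined on oriented triangles $xyz$ of $\mathcal{Y}$ by $\delta\alpha(xyz)=\alpha(xy)\alpha(yz)\alpha(zx)$. It is a $1$-cocycle if $\delta\alpha\equiv\mathrm{Id}$. Let $C^1(\mathcal{Y},\mathrm{Sym})$ (resp. $Z^1(\mathcal{Y},\mathrm{Sym})$) be the disjoint union over all $N\ge 2$ of the sets of $1$-cochains (resp. $1$-cocycles) with $\mathrm{Sym}(N)$ coefficients. Metric: for $\sigma\in\mathrm{Sym}(n)$, $\tau\in\mathrm{Sym}(N)$ with $N\ge n$, $d_h(\sigma,\tau)=d_h(\tau,\sigma)=1-\frac{|\{i\in[n]\,:\,\sigma(i)=\tau(i)\}|}{N}$. Measures: $\mu_2$ is the uniform probability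 measure on the triangles of $\mathcal{Y}$, and $\mu_1$ is the probability measure on edges with $\mu_1(e)$ proportional to the number of triangles of $\mathcal{Y}$ containing $e$ (if $\mathcal{Y}$ has no triangles, set $h_1(\mathcal{Y},\mathrm{Sym})=\infty$). Put $d(\alpha,\beta)=\mathbb{E}_{e\sim\mu_1}[d_h(\alpha(e),\beta(e))]$, $\|\delta\alpha\|=\mathbb{E}_{\Delta\sim\mu_2}[d_h(\delta\alpha(\Delta),\mathrm{Id})]$ (these do not depend on chosen orientations), and $d(\alpha,Z^1(\mathcal{Y},\mathrm{Sym}))=\inf_{\varphi\in Z^1(\mathcal{Y},\mathrm{Sym})}d(\alpha,\varphi)$. Cocycle Cheeger constant: $h_1(\mathcal{Y},\mathrm{Sym})=\inf\Big\{\frac{\|\delta\alpha\|}{d(\alpha,Z^1(\mathcal{Y},\mathrm{Sym}))} : \alpha\in C^1(\mathcal{Y},\mathrm{Sym}),\ \|\delta\alpha\|\ne 0\Big\}$ (with $\inf\emptyset=\infty$). *)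

theory Defs
  imports
    "HOL-Probability.Probability"
    "HOL-Combinatorics.Permutations"
begin

text \<open>A complex is given by the set of its nonempty simplices.\<close>

definition edges :: "'a set set \<Rightarrow> 'a set set" where
  "edges Y = {e \<in> Y. card e = 2}"

definition triangles :: "'a set set \<Rightarrow> 'a set set" where
  "triangles Y = {t \<in> Y. card t = 3}"

definition oriented_edges :: "'a set set \<Rightarrow> ('a \<times> 'a) set" where
  "oriented_edges Y = {(x, y). {x, y} \<in> edges Y}"

definition oriented_triangles :: "'a set set \<Rightarrow> ('a \<times> 'a \<times> 'a) set" where
  "oriented_triangles Y = {(x, y, z). {x, y, z} \<in> triangles Y}"

definition linial_meshulam :: "nat \<Rightarrow> real \<Rightarrow> nat set set pmf" where
  "linial_meshulam n p =
     map_pmf (\<lambda>f. {s. s \<subseteq> {1..n} \<and> (card s = 1 \<or> card s = 2)} \<union>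
                  {t. t \<subseteq> {1..n} \<and> card t = 3 \<and> f t})
       (Pi_pmf {t. t \<subseteq> {1..n} \<and> card t = 3} False (\<lambda>_. bernoulli_pmf p))"

definition Sym :: "nat \<Rightarrow> (nat \<Rightarrow> nat) set" where
  "Sym N = {\<sigma>. \<sigma> permutes {1..N}}"

text \<open>The distance between \<open>\<sigma> \<in> Sym m\<close> and \<open>\<tau> \<in> Sym N\<close>, for \<open>m\<close> and \<open>N\<close> in
  either order.  The degrees have to be passed explicitly, because a permutation is represented by
  a function that is the identity outside \<open>{1..N}\<close> and so does not determine \<open>N\<close>.\<close>

definition perm_dist :: "nat \<Rightarrow> (nat \<Rightarrow> nat) \<Rightarrow> nat \<Rightarrow> (nat \<Rightarrow> nat) \<Rightarrow> real" where
  "perm_dist m \<sigma> N \<tau> =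
     1 - real (card {i \<in> {1..min m N}. \<sigma> i = \<tau> i}) / real (max m N)"

type_synonym 'a cochain = "'a \<times> 'a \<Rightarrow> nat \<Rightarrow> nat"

definition cochains :: "'a set set \<Rightarrow> nat \<Rightarrow> 'a cochain set" where
  "cochains Y N =
     {\<alpha> \<in> oriented_edges Y \<rightarrow>\<^sub>E Sym N. \<forall>(x, y) \<in> oriented_edges Y. \<alpha> (y, x) = inv (\<alpha> (x, y))}"

definition coboundary :: "'a cochain \<Rightarrow> 'a \<times> 'a \<times> 'a \<Rightarrow> nat \<Rightarrow> nat" where
  "coboundary \<alpha> = (\<lambda>(x, y, z). \<alpha> (x, y) \<circ> \<alpha> (y, z) \<circ> \<alpha> (z, x))"

definition cocycles :: "'a set set \<Rightarrow> nat \<Rightarrow> 'a cochain set" where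
  "cocycles Y N = {\<alpha> \<in> cochains Y N. \<forall>t \<in> oriented_triangles Y. coboundary \<alpha> t = id}"

text \<open>The disjoint unions over all degrees: an element is a pair \<open>(N, \<alpha>)\<close>.\<close>

definition C1 :: "'a set set \<Rightarrow> (nat \<times> 'a cochain) set" where
  "C1 Y = (SIGMA N:{2..}. cochains Y N)"

definition Z1 :: "'a set set \<Rightarrow> (nat \<times> 'a cochain) set" where
  "Z1 Y = (SIGMA N:{2..}. cocycles Y N)"

definition mu1 :: "'a set set \<Rightarrow> 'a set \<Rightarrow> real" where
  "mu1 Y e = real (card {t \<in> triangles Y. e \<subseteq> t}) /
             (\<Sum>e'\<in>edges Y. real (card {t \<in> triangles Y. e' \<subseteq> t}))"

definition mu2 :: "'a set set \<Rightarrow> 'a set \<Rightarrow> real" where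
  "mu2 Y t = 1 / real (card (triangles Y))"

text \<open>Arbitrary orientations; the quantities below do not depend on the choice, by
  \<open>perm_dist_swap\<close> and \<open>perm_dist_coboundary_orientation\<close>.\<close>

definition orient_edge :: "'a set \<Rightarrow> 'a \<times> 'a" where
  "orient_edge e = (SOME (x, y). {x, y} = e)"

definition orient_triangle :: "'a set \<Rightarrow> 'a \<times> 'a \<times> 'a" where
  "orient_triangle t = (SOME (x, y, z). {x, y, z} = t)"

definition cochain_dist :: "'a set set \<Rightarrow> nat \<times> 'a cochain \<Rightarrow> nat \<times> 'a cochain \<Rightarrow> real" where
  "cochain_dist Y = (\<lambda>(m, \<alpha>) (N, \<beta>).
     \<Sum>e\<in>edges Y. mu1 Y e * perm_dist m (\<alpha> (orient_edge e)) N (\<beta> (orient_edge e)))"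

definition coboundary_norm :: "'a set set \<Rightarrow> nat \<times> 'a cochain \<Rightarrow> real" where
  "coboundary_norm Y = (\<lambda>(N, \<alpha>).
     \<Sum>t\<in>triangles Y. mu2 Y t * perm_dist N (coboundary \<alpha> (orient_triangle t)) N id)"

definition dist_Z1 :: "'a set set \<Rightarrow> nat \<times> 'a cochain \<Rightarrow> real" where
  "dist_Z1 Y a = (INF \<phi>\<in>Z1 Y. cochain_dist Y a \<phi>)"

text \<open>The quotient is taken in the extended reals, where a positive number divided by \<open>0\<close>
  is \<open>\<infinity>\<close>, and the infimum of the empty set is \<open>\<infinity>\<close>.\<close>

definition h1 :: "'a set set \<Rightarrow> ereal" where
  "h1 Y = (if triangles Y = {} then \<infinity>
           else INF a\<in>{a \<in> C1 Y. coboundary_norm Y a \<noteq> 0}.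
                  ereal (coboundary_norm Y a) / ereal (dist_Z1 Y a))"


lemma perm_dist_inv:
  assumes "\<sigma> \<in> Sym m" "\<tau> \<in> Sym N"
  shows "perm_dist m (inv \<sigma>) N (inv \<tau>) = perm_dist m \<sigma> N \<tau>"
proof -
  have s: "\<sigma> permutes {1..m}" and t: "\<tau> permutes {1..N}"
    using assms by (auto simp: Sym_def)
  have "bij_betw \<sigma> {i \<in> {1..min m N}. \<sigma> i = \<tau> i} {i \<in> {1..min m N}. inv \<sigma> i = inv \<tau> i}"
  proof (rule bij_betw_byWitness[where f' = "inv \<sigma>"])
    show "\<forall>i\<in>{i \<in> {1..min m N}. \<sigma> i = \<tau> i}. inv \<sigma> (\<sigma> i) = i"
      using permutes_inverses(2)[OF s] by blast
    show "\<forall>j\<in>{i \<in> {1..min m N}. inv \<sigma> i = inv \<tau> i}. \<sigma> (inv \<sigma> j) = j"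
      using permutes_inverses(1)[OF s] by blast
    show "\<sigma> ` {i \<in> {1..min m N}. \<sigma> i = \<tau> i} \<subseteq> {i \<in> {1..min m N}. inv \<sigma> i = inv \<tau> i}"
    proof clarify
      fix i assume i: "i \<in> {1..min m N}" "\<sigma> i = \<tau> i"
      have "\<sigma> i \<in> {1..m}" "\<tau> i \<in> {1..N}"
        using i permutes_in_image[OF s, of i] permutes_in_image[OF t, of i] by auto
      moreover have "inv \<sigma> (\<sigma> i) = i" "inv \<tau> (\<tau> i) = i"
        by (rule permutes_inverses(2)[OF s], rule permutes_inverses(2)[OF t])
      ultimately show "\<sigma> i \<in> {1..min m N} \<and> inv \<sigma> (\<sigma> i) = inv \<tau> (\<sigma> i)"
        using i by auto
    qed
    show "inv \<sigma> ` {i \<in> {1..min m N}. inv \<sigma> i = inv \<tau> i} \<subseteq> {i \<in> {1..min m N}. \<sigma> i = \<tau> i}"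
    proof clarify
      fix i assume i: "i \<in> {1..min m N}" "inv \<sigma> i = inv \<tau> i"
      have "inv \<sigma> i \<in> {1..m}" "inv \<tau> i \<in> {1..N}"
        using i permutes_in_image[OF permutes_inv[OF s], of i]
          permutes_in_image[OF permutes_inv[OF t], of i] by auto
      moreover have "\<sigma> (inv \<sigma> i) = i" "\<tau> (inv \<tau> i) = i"
        by (rule permutes_inverses(1)[OF s], rule permutes_inverses(1)[OF t])
      ultimately show "inv \<sigma> i \<in> {1..min m N} \<and> \<sigma> (inv \<sigma> i) = \<tau> (inv \<sigma> i)"
        using i by auto
    qed
  qed
  then show ?thesis
    by (simp add: perm_dist_def bij_betw_same_card)
qed

lemma perm_dist_conj:
  assumes "\<sigma> \<in> Sym N" "\<tau> \<in> Sym N"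
  shows "perm_dist N (\<sigma> \<circ> \<tau>) N id = perm_dist N (\<tau> \<circ> \<sigma>) N id"
proof -
  have s: "\<sigma> permutes {1..N}" and t: "\<tau> permutes {1..N}"
    using assms by (auto simp: Sym_def)
  have "bij_betw \<tau> {i \<in> {1..N}. \<sigma> (\<tau> i) = i} {i \<in> {1..N}. \<tau> (\<sigma> i) = i}"
    by (rule bij_betw_byWitness[where f' = \<sigma>])
      (use permutes_in_image[OF s] permutes_in_image[OF t] in \<open>auto simp del: atLeastAtMost_iff\<close>)
  then show ?thesis
    by (simp add: perm_dist_def bij_betw_same_card)
qed

lemma perm_dist_swap:
  assumes "\<alpha> \<in> cochains Y m" "\<beta> \<in> cochains Y N" "(x, y) \<in> oriented_edges Y"
  shows "perm_dist m (\<alpha> (y, x)) N (\<beta> (y, x)) = perm_dist m (\<alpha> (x, y)) N (\<beta> (x, y))"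
proof -
  have "\<alpha> (x, y) \<in> Sym m" "\<beta> (x, y) \<in> Sym N"
    "\<alpha> (y, x) = inv (\<alpha> (x, y))" "\<beta> (y, x) = inv (\<beta> (x, y))"
    using assms by (auto simp: cochains_def)
  then show ?thesis
    by (simp add: perm_dist_inv)
qed

text \<open>The second premise says that \<open>Y\<close> contains the edges of the triangle.\<close>

lemma perm_dist_coboundary_orientation:
  assumes "\<alpha> \<in> cochains Y N" "{(x, y), (y, z), (z, x)} \<subseteq> oriented_edges Y"
  shows "perm_dist N (coboundary \<alpha> (y, z, x)) N id = perm_dist N (coboundary \<alpha> (x, y, z)) N id"
    and "perm_dist N (coboundary \<alpha> (x, z, y)) N id = perm_dist N (coboundary \<alpha> (x, y, z)) N id"
proof -
  have p: "\<alpha> (x, y) \<in> Sym N" "\<alpha> (y, z) \<in> Sym N" "\<alpha> (z, x) \<in> Sym N"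
    using assms by (auto simp: cochains_def)
  have i: "\<alpha> (y, x) = inv (\<alpha> (x, y))" "\<alpha> (z, y) = inv (\<alpha> (y, z))" "\<alpha> (x, z) = inv (\<alpha> (z, x))"
    using assms by (auto simp: cochains_def)
  have comp: "\<alpha> (y, z) \<circ> \<alpha> (z, x) \<in> Sym N" "\<alpha> (x, y) \<circ> (\<alpha> (y, z) \<circ> \<alpha> (z, x)) \<in> Sym N"
    "id \<in> Sym N"
    using p by (auto simp: Sym_def intro: permutes_compose permutes_id)
  show "perm_dist N (coboundary \<alpha> (y, z, x)) N id = perm_dist N (coboundary \<alpha> (x, y, z)) N id"
    using perm_dist_conj[OF p(1) comp(1)] by (simp add: coboundary_def comp_assoc)
  have b: "bij (\<alpha> (x, y))" "bij (\<alpha> (y, z))" "bij (\<alpha> (z, x))"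
    using p by (auto simp: Sym_def permutes_bij)
  have "coboundary \<alpha> (x, z, y) = inv (\<alpha> (x, y) \<circ> (\<alpha> (y, z) \<circ> \<alpha> (z, x)))"
    using b by (simp add: coboundary_def i o_inv_distrib bij_comp comp_assoc)
  then show "perm_dist N (coboundary \<alpha> (x, z, y)) N id = perm_dist N (coboundary \<alpha> (x, y, z)) N id"
    using perm_dist_inv[OF comp(2,3)] by (simp add: coboundary_def comp_assoc)
qed

end

theory Submission
  imports Defs
begin

text \<open>Since \<open>\<delta>\<alpha>\<close> on a triangle is at most the sum of the distances from \<open>\<alpha>\<close> to a cocycle on its
  three edges, \<open>h\<^sub>1 \<le> 3\<close> as soon as there is a triangle.

  For the lower bound, a first moment computation shows that a.a.s. every edge-connected set \<open>F\<close> of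
  triangles has at most \<open>2 / \<eta>\<close> elements and spans at least \<open>|F| + 1\<close> vertices.  Gluing the
  triangles of such an \<open>F\<close> one by one, every step but possibly one brings a new vertex.  As long as
  there has been no exception (a two-tree), \<open>\<alpha>\<close> can be corrected to a cocycle without changing its
  values at an arbitrarily prescribed vertex, each edge moving by at most the total defect of \<open>F\<close>;
  choosing that vertex on the exceptional triangle, the same bound survives the exceptional step.
  Summing over edges, which are weighted by the number of triangles containing them, costs
  the factor \<open>max |F| \<le> 2 / \<eta>\<close>.\<close>

section \<open>The Hamming distance of permutations\<close>

lemma Sym_id: "id \<in> Sym N"
  by (simp add: Sym_def permutes_id)

lemma Sym_comp: "\<sigma> \<in> Sym N \<Longrightarrow> \<tau> \<in> Sym N \<Longrightarrow> \<sigma> \<circ> \<tau> \<in> Sym N"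
  by (simp add: Sym_def permutes_compose)

lemma Sym_inv: "\<sigma> \<in> Sym N \<Longrightarrow> inv \<sigma> \<in> Sym N"
  by (simp add: Sym_def permutes_inv)

lemma Sym_bij: "\<sigma> \<in> Sym N \<Longrightarrow> bij \<sigma>"
  by (auto simp: Sym_def permutes_bij)

lemma Sym_inv_comp:
  assumes "\<sigma> \<in> Sym N"
  shows "inv \<sigma> \<circ> \<sigma> = id" "\<sigma> \<circ> inv \<sigma> = id"
    "inv \<sigma> \<circ> (\<sigma> \<circ> \<tau>) = \<tau>" "\<sigma> \<circ> (inv \<sigma> \<circ> \<tau>) = \<tau>"
  using permutes_inv_o[of \<sigma> "{1..N}"] assms by (auto simp: Sym_def fun_eq_iff permutes_inverses)

lemma Sym_inv_o: "\<sigma> \<in> Sym N \<Longrightarrow> \<tau> \<in> Sym N \<Longrightarrow> inv (\<sigma> \<circ> \<tau>) = inv \<tau> \<circ> inv \<sigma>"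
  by (meson Sym_bij o_inv_distrib)

lemma Sym_inv_inv: "\<sigma> \<in> Sym N \<Longrightarrow> inv (inv \<sigma>) = \<sigma>"
  by (meson Sym_bij inv_inv_eq)

lemma perm_dist_eq_count:
  assumes "N > 0"
  shows "perm_dist N \<sigma> N \<tau> = real (card {i \<in> {1..N}. \<sigma> i \<noteq> \<tau> i}) / real N"
proof -
  have "card {1..N} = card {i \<in> {1..N}. \<sigma> i = \<tau> i} + card {i \<in> {1..N}. \<sigma> i \<noteq> \<tau> i}"
    by (subst card_Un_disjoint[symmetric])
      (auto intro!: arg_cong[where f = card] simp del: card_atLeastAtMost)
  then have "real N = real (card {i \<in> {1..N}. \<sigma> i = \<tau> i}) + real (card {i \<in> {1..N}. \<sigma> i \<noteq> \<tau> i})"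
    by (simp flip: of_nat_add)
  then show ?thesis using assms by (simp add: perm_dist_def field_simps)
qed

lemma perm_dist_nonneg: "0 \<le> perm_dist m \<sigma> N \<tau>"
proof -
  have "card {i \<in> {1..min m N}. \<sigma> i = \<tau> i} \<le> card {1..min m N}"
    by (rule card_mono) auto
  then have "real (card {i \<in> {1..min m N}. \<sigma> i = \<tau> i}) \<le> real (max m N)"
    by (simp only: of_nat_le_iff card_atLeastAtMost)
  then show ?thesis
    by (cases "max m N = 0") (simp_all add: perm_dist_def divide_le_eq_1 less_max_iff_disj)
qed

lemma perm_dist_self: "N > 0 \<Longrightarrow> perm_dist N \<sigma> N \<sigma> = 0"
  by (simp add: perm_dist_eq_count)

lemma perm_dist_triangle:
  assumes "N > 0"
  shows "perm_dist N \<sigma> N \<rho> \<le> perm_dist N \<sigma> N \<tau> + perm_dist N \<tau> N \<rho>"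
proof -
  have "card {i \<in> {1..N}. \<sigma> i \<noteq> \<rho> i}
      \<le> card ({i \<in> {1..N}. \<sigma> i \<noteq> \<tau> i} \<union> {i \<in> {1..N}. \<tau> i \<noteq> \<rho> i})"
    by (rule card_mono) auto
  also have "\<dots> \<le> card {i \<in> {1..N}. \<sigma> i \<noteq> \<tau> i} + card {i \<in> {1..N}. \<tau> i \<noteq> \<rho> i}"
    by (rule card_Un_le)
  finally have "real (card {i \<in> {1..N}. \<sigma> i \<noteq> \<rho> i})
      \<le> real (card {i \<in> {1..N}. \<sigma> i \<noteq> \<tau> i}) + real (card {i \<in> {1..N}. \<tau> i \<noteq> \<rho> i})"
    by linarith
  from divide_right_mono[OF this, of "real N"] show ?thesis
    by (simp only: perm_dist_eq_count[OF assms] add_divide_distrib)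
qed

lemma perm_dist_sym: "perm_dist m \<sigma> N \<tau> = perm_dist N \<tau> m \<sigma>"
  unfolding perm_dist_def min.commute[of m] max.commute[of m] eq_commute[of "\<sigma> _"] ..

lemma perm_dist_comp_left:
  assumes "\<rho> \<in> Sym N"
  shows "perm_dist N (\<rho> \<circ> \<sigma>) N (\<rho> \<circ> \<tau>) = perm_dist N \<sigma> N \<tau>"
proof -
  have "inj \<rho>" using assms by (auto simp: Sym_def permutes_inj)
  then show ?thesis by (simp add: perm_dist_def inj_eq)
qed

lemma perm_dist_comp_right:
  assumes "\<rho> \<in> Sym N"
  shows "perm_dist N (\<sigma> \<circ> \<rho>) N (\<tau> \<circ> \<rho>) = perm_dist N \<sigma> N \<tau>"
proof -
  have p: "\<rho> permutes {1..N}" using assms by (simp add: Sym_def)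
  have "bij_betw \<rho> {i \<in> {1..N}. \<sigma> (\<rho> i) = \<tau> (\<rho> i)} {i \<in> {1..N}. \<sigma> i = \<tau> i}"
    by (rule bij_betw_byWitness[where f' = "inv \<rho>"])
      (use permutes_in_image[OF p] permutes_in_image[OF permutes_inv[OF p]] permutes_inverses[OF p]
        in \<open>auto simp del: atLeastAtMost_iff\<close>)
  then show ?thesis by (simp add: perm_dist_def bij_betw_same_card)
qed

text \<open>The factors may live in a different degree \<open>N\<close> than \<open>m\<close>: a point of \<open>{1..max m N}\<close> not fixed
  by the product is charged to the first factor at which the two orbits of the point separate.\<close>

lemma perm_dist_triple_le:
  assumes s: "\<sigma>1 \<in> Sym m" "\<sigma>2 \<in> Sym m" "\<sigma>3 \<in> Sym m"
    and t: "\<tau>1 \<in> Sym N" "\<tau>2 \<in> Sym N" "\<tau>3 \<in> Sym N"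
    and flat: "\<tau>1 \<circ> \<tau>2 \<circ> \<tau>3 = id" and m: "m > 0"
  shows "perm_dist m (\<sigma>1 \<circ> \<sigma>2 \<circ> \<sigma>3) m id
     \<le> perm_dist m \<sigma>1 N \<tau>1 + perm_dist m \<sigma>2 N \<tau>2 + perm_dist m \<sigma>3 N \<tau>3"
proof -
  define A where "A = (\<lambda>\<sigma> \<tau>. {i \<in> {1..min m N}. \<sigma> i = (\<tau> i :: nat)})"
  define M where "M = max m N"
  define X where "X = {i \<in> {1..m}. (\<sigma>1 \<circ> \<sigma>2 \<circ> \<sigma>3) i = i}"
  have p: "\<sigma>2 permutes {1..m}" "\<sigma>3 permutes {1..m}" "\<tau>2 permutes {1..N}" "\<tau>3 permutes {1..N}"
    using s t by (auto simp: Sym_def)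
  have M: "M > 0" using m by (simp add: M_def)
  have fin: "finite (A \<sigma> \<tau>)" for \<sigma> \<tau> by (simp add: A_def)
  have cA: "card ({1..M} - A \<sigma> \<tau>) = M - card (A \<sigma> \<tau>) \<and> card (A \<sigma> \<tau>) \<le> M" for \<sigma> \<tau>
  proof -
    have sub: "A \<sigma> \<tau> \<subseteq> {1..M}" by (auto simp: A_def M_def)
    show ?thesis using card_Diff_subset[OF fin sub] card_mono[OF _ sub] by simp
  qed
  \<comment> \<open>If all three factors agree along the orbit of \<open>i\<close>, the
    \<sigma>-product sends \<open>i\<close> where the \<tau>-product does, namely to
    \<open>i\<close>. Points beyond \<open>min m N\<close> lie outside every \<open>A\<close> and
    fall into the first set.\<close>
  have *: "{1..M} - X \<subseteq> ({1..M} - A \<sigma>3 \<tau>3) \<union> inv \<sigma>3 ` ({1..M} - A \<sigma>2 \<tau>2)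
      \<union> inv (\<sigma>2 \<circ> \<sigma>3) ` ({1..M} - A \<sigma>1 \<tau>1)"
  proof
    fix i assume i: "i \<in> {1..M} - X"
    show "i \<in> ({1..M} - A \<sigma>3 \<tau>3) \<union> inv \<sigma>3 ` ({1..M} - A \<sigma>2 \<tau>2)
        \<union> inv (\<sigma>2 \<circ> \<sigma>3) ` ({1..M} - A \<sigma>1 \<tau>1)"
    proof (cases "i \<in> A \<sigma>3 \<tau>3")
      case True
      then have 3: "i \<in> {1..min m N}" "\<sigma>3 i = \<tau>3 i" by (auto simp: A_def)
      then have j: "\<sigma>3 i \<in> {1..min m N}"
        using permutes_in_image[OF p(2), of i] permutes_in_image[OF p(4), of i] by auto
      have ii: "i = inv \<sigma>3 (\<sigma>3 i)" using permutes_inverses(2)[OF p(2)] by simp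
      show ?thesis
      proof (cases "\<sigma>3 i \<in> A \<sigma>2 \<tau>2")
        case True
        then have 2: "\<sigma>2 (\<sigma>3 i) = \<tau>2 (\<sigma>3 i)" by (auto simp: A_def)
        then have k: "\<sigma>2 (\<sigma>3 i) \<in> {1..min m N}"
          using j permutes_in_image[OF p(1), of "\<sigma>3 i"] permutes_in_image[OF p(3), of "\<sigma>3 i"] by auto
        have ik: "i = inv (\<sigma>2 \<circ> \<sigma>3) (\<sigma>2 (\<sigma>3 i))"
          using permutes_inverses(2)[OF permutes_compose[OF p(2,1)], of i] by simp
        have "\<sigma>2 (\<sigma>3 i) \<notin> A \<sigma>1 \<tau>1"
        proof
          assume "\<sigma>2 (\<sigma>3 i) \<in> A \<sigma>1 \<tau>1"
          then have "\<sigma>1 (\<sigma>2 (\<sigma>3 i)) = (\<tau>1 \<circ> \<tau>2 \<circ> \<tau>3) i" using 2 3 by (auto simp: A_def)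
          then have "i \<in> X" using flat 3 by (auto simp: X_def)
          then show False using i by blast
        qed
        moreover have "\<sigma>2 (\<sigma>3 i) \<in> {1..M}" using k by (auto simp: M_def)
        ultimately show ?thesis using ik by blast
      next
        case False
        moreover have "\<sigma>3 i \<in> {1..M}" using j by (auto simp: M_def)
        ultimately show ?thesis using ii by blast
      qed
    qed (use i in auto)
  qed
  have "M - card X \<le> card ({1..M} - X)"
    using diff_card_le_card_Diff[of X "{1..M}"] by (simp add: X_def)
  also have "\<dots> \<le> card (({1..M} - A \<sigma>3 \<tau>3) \<union> inv \<sigma>3 ` ({1..M} - A \<sigma>2 \<tau>2)
      \<union> inv (\<sigma>2 \<circ> \<sigma>3) ` ({1..M} - A \<sigma>1 \<tau>1))"
    by (rule card_mono[OF _ *]) auto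
  also have "\<dots> \<le> card ({1..M} - A \<sigma>3 \<tau>3) + card (inv \<sigma>3 ` ({1..M} - A \<sigma>2 \<tau>2))
      + card (inv (\<sigma>2 \<circ> \<sigma>3) ` ({1..M} - A \<sigma>1 \<tau>1))"
    by (meson add_le_mono card_Un_le le_trans order_refl)
  also have "\<dots> \<le> card ({1..M} - A \<sigma>3 \<tau>3) + card ({1..M} - A \<sigma>2 \<tau>2) + card ({1..M} - A \<sigma>1 \<tau>1)"
    by (intro add_mono card_image_le) auto
  finally have "real M - real (card X) \<le> (real M - real (card (A \<sigma>1 \<tau>1)))
      + (real M - real (card (A \<sigma>2 \<tau>2))) + (real M - real (card (A \<sigma>3 \<tau>3)))"
    using cA[of \<sigma>1 \<tau>1] cA[of \<sigma>2 \<tau>2] cA[of \<sigma>3 \<tau>3] by linarith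
  then have "(real M - real (card X)) / real M \<le> ((real M - real (card (A \<sigma>1 \<tau>1)))
      + (real M - real (card (A \<sigma>2 \<tau>2))) + (real M - real (card (A \<sigma>3 \<tau>3)))) / real M"
    by (rule divide_right_mono) simp
  moreover have "perm_dist m \<sigma> N \<tau> = (real M - real (card (A \<sigma> \<tau>))) / real M" for \<sigma> \<tau>
    using M by (simp only: perm_dist_def A_def diff_divide_distrib flip: M_def) simp
  ultimately have "1 - real (card X) / real M
      \<le> perm_dist m \<sigma>1 N \<tau>1 + perm_dist m \<sigma>2 N \<tau>2 + perm_dist m \<sigma>3 N \<tau>3"
    using M by (simp add: add_divide_distrib diff_divide_distrib)
  \<comment> \<open>The factors are compared with denominator \<open>M\<close>, the product with
    \<open>m\<close>. As \<open>m\<close> is at most \<open>M\<close>, passing to \<open>m\<close>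
    only lowers the left-hand side.\<close>
  moreover have "real (card X) / real M \<le> real (card X) / real m"
    using m by (intro divide_left_mono) (auto simp: M_def)
  ultimately show ?thesis by (simp add: perm_dist_def X_def)
qed

section \<open>Correcting a cochain on an edge-connected set of triangles\<close>

text \<open>Values on all ordered pairs remove membership side conditions from the algebra;
  \<open>extend\<close> and \<open>restrict\<close> pass between this form and
  \<open>cochains Y N\<close>.\<close>

definition total_cochain :: "nat \<Rightarrow> 'a cochain \<Rightarrow> bool" where
  "total_cochain N \<alpha> \<longleftrightarrow> (\<forall>x y. \<alpha> (x, y) \<in> Sym N \<and> \<alpha> (y, x) = inv (\<alpha> (x, y)))"

definition spans :: "'a set set \<Rightarrow> 'a \<Rightarrow> 'a \<Rightarrow> bool" where
  "spans F x y \<longleftrightarrow> x \<noteq> y \<and> (\<exists>t\<in>F. {x, y} \<subseteq> t)"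

text \<open>The cocycle condition with the third edge moved to the other side, so that it determines
  the value on one edge from those on the other two.\<close>

definition flat :: "'a set set \<Rightarrow> 'a cochain \<Rightarrow> bool" where
  "flat F \<phi> \<longleftrightarrow> (\<forall>x y z. {x, y, z} \<in> F \<longrightarrow> \<phi> (x, y) \<circ> \<phi> (y, z) = \<phi> (x, z))"

lemma total_cochainD:
  assumes "total_cochain N \<alpha>"
  shows "\<alpha> (x, y) \<in> Sym N" "\<alpha> (x, y) = inv (\<alpha> (y, x))"
  using assms unfolding total_cochain_def by blast+

lemma spans_sym: "spans F x y \<longleftrightarrow> spans F y x"
  by (auto simp: spans_def)

lemma spans_insert: "spans (insert t F) x y \<longleftrightarrow> spans F x y \<or> x \<noteq> y \<and> {x, y} \<subseteq> t"
  by (auto simp: spans_def)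

lemma card_3_distinct: "card {x, y, z} = 3 \<longleftrightarrow> x \<noteq> y \<and> y \<noteq> z \<and> x \<noteq> z"
  by (cases "x = y"; cases "y = z"; cases "x = z") (simp_all add: card_insert_if)

lemma triangle_orientations:
  assumes "card {a, b, c} = 3" "{x, y, z} = {a, b, c}"
  shows "(x, y, z) \<in> {(a, b, c), (b, c, a), (c, a, b), (a, c, b), (c, b, a), (b, a, c)}"
proof -
  have "x \<noteq> y" "y \<noteq> z" "x \<noteq> z" "a \<noteq> b" "b \<noteq> c" "a \<noteq> c"
    using assms card_3_distinct by metis+
  then show ?thesis using assms(2) by (simp add: set_eq_iff) metis
qed

text \<open>All six ordered edges can be written through \<open>\<phi> (a, b)\<close> and
  \<open>\<phi> (b, c)\<close>, after which each orientation is a cancellation in the group. Hence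
  flatness need only be checked for one ordering.\<close>

lemma total_cochain_triangle:
  assumes \<phi>: "total_cochain N \<phi>" and flat: "\<phi> (a, b) \<circ> \<phi> (b, c) = \<phi> (a, c)"
    and t: "card {a, b, c} = 3" "{x, y, z} = {a, b, c}"
  shows "\<phi> (x, y) \<circ> \<phi> (y, z) = \<phi> (x, z)"
proof -
  note S = total_cochainD(1)[OF \<phi>]
  have e: "\<phi> (b, a) = inv (\<phi> (a, b))" "\<phi> (c, b) = inv (\<phi> (b, c))"
    "\<phi> (a, c) = \<phi> (a, b) \<circ> \<phi> (b, c)" "\<phi> (c, a) = inv (\<phi> (b, c)) \<circ> inv (\<phi> (a, b))"
    using total_cochainD(2)[OF \<phi>] flat Sym_inv_o[OF S S] by metis+
  show ?thesis
    using triangle_orientations[OF t]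
    by (auto simp: e comp_assoc Sym_inv_comp[OF S] Sym_inv_comp[OF Sym_inv[OF S]] Sym_inv_inv[OF S])
qed

section \<open>Two-trees and edge-connected families of triangles\<close>

inductive two_tree :: "'a set set \<Rightarrow> bool" where
  base: "card t = 3 \<Longrightarrow> two_tree {t}"
| step: "two_tree F \<Longrightarrow> spans F a b \<Longrightarrow> z \<notin> \<Union>F \<Longrightarrow> two_tree (insert {a, b, z} F)"

text \<open>Connectivity through shared edges, given by a gluing order so that cochains can be
  corrected one triangle at a time. Unlike in \<open>two_tree\<close>, the apex \<open>z\<close> may
  be an old vertex.\<close>

inductive edge_connected :: "'a set set \<Rightarrow> bool" where
  base: "card t = 3 \<Longrightarrow> edge_connected {t}"
| step: "edge_connected F \<Longrightarrow> spans F a b \<Longrightarrow> card {a, b, z} = 3 \<Longrightarrow> {a, b, z} \<notin> F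
    \<Longrightarrow> edge_connected (insert {a, b, z} F)"

lemma spans_new_card: "spans F a b \<Longrightarrow> z \<notin> \<Union>F \<Longrightarrow> card {a, b, z} = 3"
  by (auto simp: spans_def card_3_distinct)

lemma edge_connected_finite:
  "edge_connected F \<Longrightarrow> finite F \<and> (\<forall>t\<in>F. card t = 3 \<and> finite t) \<and> F \<noteq> {}"
  by (induction rule: edge_connected.induct) (auto intro: card_ge_0_finite)

lemma edge_connected_card: "edge_connected F \<Longrightarrow> card (\<Union>F) \<le> card F + 2"
proof (induction rule: edge_connected.induct)
  case (step F a b z)
  have "\<Union>(insert {a, b, z} F) = insert z (\<Union>F)"
    using step(2) by (auto simp: spans_def)
  moreover have "card (insert z (\<Union>F)) \<le> Suc (card (\<Union>F))" by (rule card_insert_le_m1) auto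
  ultimately show ?case using step edge_connected_finite[OF step(1)] by simp
qed simp

text \<open>The stages of the gluing order realise every size. This cuts a large family down to a
  prescribed size, so that finitely many types have to be excluded in the random complex.\<close>

lemma edge_connected_subset:
  "edge_connected F \<Longrightarrow> 1 \<le> k \<Longrightarrow> k \<le> card F \<Longrightarrow> \<exists>F'\<subseteq>F. edge_connected F' \<and> card F' = k"
proof (induction rule: edge_connected.induct)
  case (base t)
  then show ?case by (auto intro!: exI[of _ "{t}"] edge_connected.base)
next
  case (step F a b z)
  note fin = edge_connected_finite[OF step(1)]
  show ?case
  proof (cases "k \<le> card F")
    case True
    then show ?thesis using step.IH step.prems by blast
  next
    case False
    then have "k = card (insert {a, b, z} F)" using step fin by simp
    then show ?thesis using edge_connected.step[OF step(1-4)] by blast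
  qed
qed

lemma two_tree_finite:
  "two_tree F \<Longrightarrow> finite F \<and> (\<forall>t\<in>F. card t = 3 \<and> finite t)"
  by (induction rule: two_tree.induct) (auto dest: spans_new_card intro: card_ge_0_finite)

text \<open>Every gluing step adds exactly one vertex, so two-trees attain the bound of
  \<open>edge_connected_card\<close>.\<close>

lemma two_tree_card: "two_tree F \<Longrightarrow> card (\<Union>F) = card F + 2"
proof (induction rule: two_tree.induct)
  case (step F a b z)
  have "\<Union>(insert {a, b, z} F) = insert z (\<Union>F)"
    using step(2) by (auto simp: spans_def)
  moreover have "{a, b, z} \<notin> F" using step(3) by blast
  ultimately show ?case using step two_tree_finite[OF step(1)] by (simp add: card_insert_if)
qed simp

text \<open>Hence a triangle glued to a two-tree along an edge, without a new vertex,
  brings at least one new edge.\<close>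

lemma two_tree_clique:
  "two_tree F \<Longrightarrow> spans F x y \<Longrightarrow> spans F y w \<Longrightarrow> spans F x w \<Longrightarrow> {x, y, w} \<in> F"
proof (induction arbitrary: x y w rule: two_tree.induct)
  case (base t)
  then have "{x, y, w} \<subseteq> t" "card {x, y, w} = 3" "finite t"
    by (auto simp: spans_def card_3_distinct intro: card_ge_0_finite)
  then show ?case using base(1) card_subset_eq[of t "{x, y, w}"] by simp
next
  case (step F a b z)
  have ab: "a \<noteq> b" "a \<noteq> z" "b \<noteq> z" using step(2,3) by (auto simp: spans_def)
  \<comment> \<open>The apex is fresh, so its only neighbours are \<open>a\<close> and
    \<open>b\<close>; a 3-clique through it must be the new triangle.\<close>
  have new: "u \<in> {a, b}" if "spans (insert {a, b, z} F) z u" for u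
  proof -
    have "\<not> spans F z u" using step(3) by (auto simp: spans_def)
    then show ?thesis using that by (auto simp: spans_insert)
  qed
  have old: "spans F u v" if "spans (insert {a, b, z} F) u v" "u \<noteq> z" "v \<noteq> z" for u v
    using that step(2) spans_sym[of F] by (auto simp: spans_insert)
  have d: "x \<noteq> y" "y \<noteq> w" "x \<noteq> w" using step.prems by (auto simp: spans_def)
  show ?case
  proof (cases "z \<in> {x, y, w}")
    case False
    then show ?thesis using step.IH step.prems old by blast
  next
    case True
    then consider "x = z" | "y = z" | "w = z" by blast
    then have "{x, y, w} = {a, b, z}"
    proof cases
      case 1
      then have "y \<in> {a, b}" "w \<in> {a, b}" using step.prems new by blast+
      then show ?thesis using 1 d by auto
    next
      case 2
      then have "x \<in> {a, b}" "w \<in> {a, b}" using step.prems new spans_sym by metis+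
      then show ?thesis using 2 d by auto
    next
      case 3
      then have "x \<in> {a, b}" "y \<in> {a, b}" using step.prems new spans_sym by metis+
      then show ?thesis using 3 d by auto
    qed
    then show ?thesis by simp
  qed
qed

section \<open>Correcting a cochain along a two-tree\<close>

locale sym_cochain =
  fixes N :: nat and \<alpha> :: "'a cochain"
  assumes N_pos: "N > 0" and total: "total_cochain N \<alpha>"
begin

abbreviation d :: "(nat \<Rightarrow> nat) \<Rightarrow> (nat \<Rightarrow> nat) \<Rightarrow> real" where
  "d \<sigma> \<tau> \<equiv> perm_dist N \<sigma> N \<tau>"

definition defect :: "'a set \<Rightarrow> real" where
  "defect t = d (coboundary \<alpha> (orient_triangle t)) id"

lemma defect_nonneg: "0 \<le> defect t"
  by (simp add: defect_def perm_dist_nonneg)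

lemmas \<alpha>_Sym = total_cochainD(1)[OF total]
lemmas \<alpha>_flip = total_cochainD(2)[OF total]

lemma coboundary_rotate: "d (coboundary \<alpha> (y, z, x)) id = d (coboundary \<alpha> (x, y, z)) id"
  using perm_dist_conj[OF \<alpha>_Sym Sym_comp[OF \<alpha>_Sym \<alpha>_Sym], of x y y z z x]
  by (simp add: coboundary_def comp_assoc)

lemma coboundary_reflect: "d (coboundary \<alpha> (x, z, y)) id = d (coboundary \<alpha> (x, y, z)) id"
proof -
  have "coboundary \<alpha> (x, z, y) = inv (coboundary \<alpha> (x, y, z))"
    using \<alpha>_flip[of y x] \<alpha>_flip[of z y] \<alpha>_flip[of x z]
    by (simp add: coboundary_def Sym_inv_o[OF \<alpha>_Sym \<alpha>_Sym]
        Sym_inv_o[OF \<alpha>_Sym Sym_comp[OF \<alpha>_Sym \<alpha>_Sym]] comp_assoc)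
  then show ?thesis
    using perm_dist_inv[OF _ Sym_id, of "coboundary \<alpha> (x, y, z)" N N]
    by (simp add: coboundary_def Sym_comp \<alpha>_Sym)
qed

text \<open>The orientation in \<open>defect\<close> is an arbitrary choice; rotations and one
  reflection reach all six orders of the vertices.\<close>

lemma defect_eq:
  assumes "card {x, y, z} = 3"
  shows "d (coboundary \<alpha> (x, y, z)) id = defect {x, y, z}"
proof -
  obtain a b c where o: "orient_triangle {x, y, z} = (a, b, c)" by (metis prod_cases3)
  have "\<exists>p. (\<lambda>(a, b, c). {a, b, c} = {x, y, z}) p" by (rule exI[of _ "(x, y, z)"]) simp
  from someI_ex[OF this] have "{a, b, c} = {x, y, z}"
    using o by (simp add: orient_triangle_def)
  from triangle_orientations[OF assms this]
  have "d (coboundary \<alpha> (a, b, c)) id = d (coboundary \<alpha> (x, y, z)) id"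
    by (auto simp only: insert_iff empty_iff prod.inject)
      (metis coboundary_rotate coboundary_reflect)+
  then show ?thesis by (simp add: defect_def o)
qed

text \<open>The invariant of the gluing process. The bound is the total defect for each single edge,
  and nothing changes off the edges of \<open>F\<close>, so a later triangle still sees \<alpha> on
  its new edges.\<close>

definition near :: "'a set set \<Rightarrow> 'a cochain \<Rightarrow> bool" where
  "near F \<phi> \<longleftrightarrow> total_cochain N \<phi> \<and> flat F \<phi> \<and> (\<forall>x y. d (\<alpha> (x, y)) (\<phi> (x, y)) \<le> sum defect F)
     \<and> (\<forall>x y. \<not> spans F x y \<longrightarrow> \<phi> (x, y) = \<alpha> (x, y))"

lemma near_empty: "near {} \<alpha>"
  using total N_pos by (simp add: near_def flat_def perm_dist_self)

text \<open>The edge \<open>bz\<close> lies in no triangle of \<open>F\<close>, so it is free to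
  take the value that flatness of the new triangle forces. It then moves by at most the defect of
  that triangle plus the moves of the other two edges; premise \<open>le\<close> keeps those two
  within the budget of \<open>F\<close>.\<close>

lemma near_extend:
  assumes near: "near F \<phi>" and F: "finite F" "\<forall>t\<in>F. card t = 3"
    and t: "card {a, b, z} = 3" "{a, b, z} \<notin> F" and new: "\<not> spans F b z"
    and le: "d (\<alpha> (a, b)) (\<phi> (a, b)) + d (\<alpha> (a, z)) (\<phi> (a, z)) \<le> sum defect F"
  shows "\<exists>\<phi>'. near (insert {a, b, z} F) \<phi>' \<and> (\<forall>x y. {x, y} \<noteq> {b, z} \<longrightarrow> \<phi>' (x, y) = \<phi> (x, y))"
proof -
  define \<sigma> where "\<sigma> = \<phi> (b, a) \<circ> \<phi> (a, z)"
  define \<phi>' where "\<phi>' = \<phi>((b, z) := \<sigma>, (z, b) := inv \<sigma>)"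
  have \<phi>: "total_cochain N \<phi>" "flat F \<phi>" using near by (auto simp: near_def)
  note S\<phi> = total_cochainD(1)[OF \<phi>(1)] and flip\<phi> = total_cochainD(2)[OF \<phi>(1)]
  have \<sigma>: "\<sigma> \<in> Sym N" by (simp add: \<sigma>_def Sym_comp S\<phi>)
  have dist: "a \<noteq> b" "b \<noteq> z" "a \<noteq> z" using t(1) by (auto simp: card_3_distinct)
  have same: "\<phi>' (x, y) = \<phi> (x, y)" if "{x, y} \<noteq> {b, z}" for x y
  proof -
    have "(x, y) \<noteq> (b, z)" "(x, y) \<noteq> (z, b)" using that by blast+
    then show ?thesis by (simp only: \<phi>'_def fun_upd_apply if_False)
  qed
  have bz: "\<phi>' (b, z) = \<sigma>" using dist by (simp add: \<phi>'_def)
  have total': "total_cochain N \<phi>'"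
    unfolding total_cochain_def
  proof (intro allI)
    fix x y
    show "\<phi>' (x, y) \<in> Sym N \<and> \<phi>' (y, x) = inv (\<phi>' (x, y))"
    proof (cases "{x, y} = {b, z}")
      case True
      then consider "x = b" "y = z" | "x = z" "y = b" by (auto simp: doubleton_eq_iff)
      then show ?thesis
        using dist by cases (simp_all add: \<phi>'_def \<sigma> Sym_inv Sym_inv_inv[OF \<sigma>])
    next
      case False
      then have "{y, x} \<noteq> {b, z}" by (simp add: insert_commute)
      then show ?thesis using False S\<phi> flip\<phi> same by metis
    qed
  qed
  have "flat (insert {a, b, z} F) \<phi>'"
    unfolding flat_def
  proof (intro allI impI)
    fix x y w assume "{x, y, w} \<in> insert {a, b, z} F"
    then consider "{x, y, w} \<in> F" | "{x, y, w} = {b, a, z}" by (auto simp: insert_commute)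
    then show "\<phi>' (x, y) \<circ> \<phi>' (y, w) = \<phi>' (x, w)"
    proof cases
      case 1
      then have "x \<noteq> y" "y \<noteq> w" "x \<noteq> w" using F(2) card_3_distinct by metis+
      then have sp: "spans F x y" "spans F y w" "spans F x w"
        using 1 by (auto simp: spans_def intro!: bexI[OF _ 1])
      \<comment> \<open>No edge of an old triangle is \<open>bz\<close>, so \<phi> and
        \<open>\<phi>'\<close> agree on old triangles.\<close>
      have "\<not> (spans F u v \<and> {u, v} = {b, z})" for u v
        using new spans_sym[of F] by (auto simp: doubleton_eq_iff)
      then show ?thesis using sp \<phi>(2) 1 by (metis same flat_def)
    next
      case 2
      show ?thesis
      proof (rule total_cochain_triangle[OF total' _ _ 2])
        show "\<phi>' (b, a) \<circ> \<phi>' (a, z) = \<phi>' (b, z)"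
          using dist by (simp add: bz same doubleton_eq_iff \<sigma>_def)
        show "card {b, a, z} = 3" using t(1) by (simp add: insert_commute)
      qed
    qed
  qed
  moreover have "d (\<alpha> (b, z)) \<sigma> \<le> sum defect (insert {a, b, z} F)"
  proof -
    let ?\<rho> = "\<alpha> (b, a) \<circ> \<alpha> (a, z)"
    \<comment> \<open>Go from \<open>\<alpha> (b, z)\<close> to the path product
      \<open>?\<rho>\<close>, at the price of the defect, and then exchange the two factors of
      \<open>?\<rho>\<close> for those of \<phi> one at a time.\<close>
    have "d (\<alpha> (b, z)) \<sigma> \<le> d (\<alpha> (b, z)) ?\<rho> + d ?\<rho> \<sigma>"
      by (rule perm_dist_triangle[OF N_pos])
    moreover have "d ?\<rho> \<sigma> \<le> d ?\<rho> (\<phi> (b, a) \<circ> \<alpha> (a, z)) + d (\<phi> (b, a) \<circ> \<alpha> (a, z)) \<sigma>"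
      by (rule perm_dist_triangle[OF N_pos])
    moreover have "d ?\<rho> (\<phi> (b, a) \<circ> \<alpha> (a, z)) = d (\<alpha> (a, b)) (\<phi> (a, b))"
      using perm_dist_inv[OF \<alpha>_Sym S\<phi>, of a b a b]
      by (simp add: perm_dist_comp_right[OF \<alpha>_Sym] \<alpha>_flip[of b a] flip\<phi>[of b a])
    moreover have "d (\<phi> (b, a) \<circ> \<alpha> (a, z)) \<sigma> = d (\<alpha> (a, z)) (\<phi> (a, z))"
      by (simp add: \<sigma>_def perm_dist_comp_left[OF S\<phi>])
    moreover have "d (\<alpha> (b, z)) ?\<rho> = defect {a, b, z}"
    proof -
      have "d (\<alpha> (b, z)) ?\<rho> = d (\<alpha> (b, z) \<circ> \<alpha> (z, b)) (?\<rho> \<circ> \<alpha> (z, b))"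
        by (simp only: perm_dist_comp_right[OF \<alpha>_Sym])
      also have "\<dots> = d (coboundary \<alpha> (b, a, z)) id"
        by (simp add: \<alpha>_flip[of z b] Sym_inv_comp[OF \<alpha>_Sym] coboundary_def perm_dist_sym)
      also have "\<dots> = defect {a, b, z}"
        using t(1) by (subst defect_eq) (simp_all add: insert_commute)
      finally show ?thesis .
    qed
    ultimately show ?thesis using le F(1) t(2) by simp
  qed
  then have "d (\<alpha> (x, y)) (\<phi>' (x, y)) \<le> sum defect (insert {a, b, z} F)" for x y
  proof (cases "{x, y} = {b, z}")
    case True
    moreover have "d (\<alpha> (z, b)) (\<phi>' (z, b)) = d (\<alpha> (b, z)) (\<phi>' (b, z))"
      using perm_dist_inv[OF \<alpha>_Sym total_cochainD(1)[OF total'], of b z b z]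
        \<alpha>_flip[of z b] total_cochainD(2)[OF total', of z b] by simp
    ultimately show ?thesis
      using \<open>d (\<alpha> (b, z)) \<sigma> \<le> _\<close> by (auto simp: doubleton_eq_iff bz)
  next
    case False
    then have "d (\<alpha> (x, y)) (\<phi>' (x, y)) \<le> sum defect F"
      using near by (simp add: same near_def)
    then show ?thesis using F(1) t(2) defect_nonneg[of "{a, b, z}"] by simp
  qed
  moreover have "\<phi>' (x, y) = \<alpha> (x, y)" if "\<not> spans (insert {a, b, z} F) x y" for x y
  proof -
    have "{x, y} \<noteq> {b, z}" "\<not> spans F x y"
      using that dist by (auto simp: spans_insert doubleton_eq_iff)
    then show ?thesis using near by (simp add: same near_def)
  qed
  ultimately show ?thesis using same total' unfolding near_def by blast
qed

text \<open>If \<open>x\<close> is the new vertex \<open>z\<close>, then no value at \<open>z\<close> may change, so the defect of the new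
  triangle is absorbed by a gauge transformation at \<open>b\<close>.\<close>

lemma two_tree_near:
  "two_tree F \<Longrightarrow> x \<in> \<Union>F \<Longrightarrow> \<exists>\<phi>. near F \<phi> \<and> (\<forall>y. \<phi> (x, y) = \<alpha> (x, y))"
proof (induction arbitrary: x rule: two_tree.induct)
  case (base t)
  \<comment> \<open>Only the edge opposite to \<open>x\<close> will be changed.\<close>
  then obtain b z where t: "t = {x, b, z}"
    by (auto simp: card_3_iff)
  have c: "card {x, b, z} = 3" using base t by simp
  obtain \<phi> where \<phi>: "near {{x, b, z}} \<phi>" "\<forall>u v. {u, v} \<noteq> {b, z} \<longrightarrow> \<phi> (u, v) = \<alpha> (u, v)"
    using near_extend[OF near_empty _ _ c] N_pos by (auto simp: spans_def perm_dist_self)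
  have "\<phi> (x, y) = \<alpha> (x, y)" for y
    using \<phi>(2) c by (auto simp: card_3_distinct doubleton_eq_iff)
  then show ?case using \<phi>(1) t by blast
next
  case (step F a b z)
  have c: "card {a, b, z} = 3" using spans_new_card step(2,3) by metis
  then have dist: "a \<noteq> b" "b \<noteq> z" "a \<noteq> z" by (auto simp: card_3_distinct)
  have t: "{a, b, z} \<notin> F" using step(3) by blast
  have zspan: "\<not> spans F z u" "\<not> spans F u z" for u using step(3) by (auto simp: spans_def)
  note fin = two_tree_finite[OF step(1)]
  \<comment> \<open>With a fresh apex \<open>az\<close> is unmoved, so the budget holds, and the
    changed edge \<open>bz\<close> misses \<open>x\<close>. Quantifying over \<open>a\<close> and
    \<open>b\<close> lets their roles be exchanged.\<close>
  have old: "\<exists>\<phi>. near (insert {a, b, z} F) \<phi> \<and> (\<forall>y. \<phi> (x, y) = \<alpha> (x, y))"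
    if x: "x \<in> \<Union>F" "x \<noteq> b" and ab: "spans F a b" and c: "card {a, b, z} = 3"
      and t: "{a, b, z} \<notin> F" for a b x
  proof -
    obtain \<phi> where \<phi>: "near F \<phi>" "\<forall>y. \<phi> (x, y) = \<alpha> (x, y)" using step.IH x by blast
    have "\<phi> (a, z) = \<alpha> (a, z)" using \<phi>(1) zspan by (auto simp: near_def)
    then have "d (\<alpha> (a, b)) (\<phi> (a, b)) + d (\<alpha> (a, z)) (\<phi> (a, z)) \<le> sum defect F"
      using \<phi>(1) by (simp add: near_def perm_dist_self N_pos)
    from near_extend[OF \<phi>(1) _ _ c t zspan(2) this] fin obtain \<phi>'
      where "near (insert {a, b, z} F) \<phi>'" "\<forall>u v. {u, v} \<noteq> {b, z} \<longrightarrow> \<phi>' (u, v) = \<phi> (u, v)"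
      by auto
    moreover have "{x, y} \<noteq> {b, z}" for y using x step(3) by (auto simp: doubleton_eq_iff)
    ultimately show ?thesis using \<phi>(2) by metis
  qed
  \<comment> \<open>An old vertex differs from at least one of \<open>a\<close> and
    \<open>b\<close>.\<close>
  consider "x = z" | "x \<in> \<Union>F" "x \<noteq> b" | "x \<in> \<Union>F" "x \<noteq> a"
    using step.prems step(2) dist by (auto simp: spans_def)
  then show ?case
  proof cases
    case 2
    then show ?thesis using old step(2) c t by blast
  next
    case 3
    then show ?thesis
      using old[of x a b] step(2) c t by (simp add: insert_commute spans_sym)
  next
    case 1
    have "a \<in> \<Union>F" using step(2) by (auto simp: spans_def)
    \<comment> \<open>Prescribing the values at \<open>a\<close> makes \<open>ab\<close> unmoved, so
      that the holonomy of the new triangle under this correction is that of \<alpha>.\<close>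
    then obtain \<phi> where \<phi>: "near F \<phi>" "\<And>y. \<phi> (a, y) = \<alpha> (a, y)" using step.IH by blast
    then have T: "total_cochain N \<phi>" by (simp add: near_def)
    note S\<phi> = total_cochainD(1)[OF T] and flip\<phi> = total_cochainD(2)[OF T]
    \<comment> \<open>The holonomy of the new triangle based at \<open>b\<close>. Gauging by
      \<open>h\<close> at \<open>b\<close> turns \<open>\<alpha> (a, b)\<close> into
      \<open>\<alpha> (a, b) \<circ> inv h\<close>, which makes the triangle flat while
      \<open>za\<close> and \<open>zb\<close> keep their values; old triangles stay flat under any
      gauge.\<close>
    define h where "h = coboundary \<alpha> (b, z, a)"
    define g where "g = (\<lambda>u. if u = b then h else id)"
    define \<psi> where "\<psi> = (\<lambda>(u, v). if spans F u v then g u \<circ> \<phi> (u, v) \<circ> inv (g v) else \<alpha> (u, v))"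
    have h: "h \<in> Sym N" by (simp add: h_def coboundary_def Sym_comp \<alpha>_Sym)
    have g: "g u \<in> Sym N" for u by (simp add: g_def h Sym_id)
    have \<psi>: "\<psi> (u, v) = g u \<circ> \<phi> (u, v) \<circ> inv (g v)" if "spans F u v" for u v
      using that by (simp add: \<psi>_def)
    have \<psi>': "\<psi> (u, v) = \<alpha> (u, v)" if "\<not> spans F u v" for u v
      using that by (simp add: \<psi>_def)
    have hd: "d h id = defect {a, b, z}"
      unfolding h_def using c by (subst defect_eq) (simp_all add: insert_commute)
    have total': "total_cochain N \<psi>"
      unfolding total_cochain_def
    proof (intro allI)
      fix u v
      show "\<psi> (u, v) \<in> Sym N \<and> \<psi> (v, u) = inv (\<psi> (u, v))"
        using flip\<phi>[of v u] \<alpha>_flip[of v u] spans_sym[of F u v]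
        by (cases "spans F u v") (simp_all add: \<psi> \<psi>' \<alpha>_Sym Sym_comp Sym_inv g S\<phi> comp_assoc
            Sym_inv_o[of _ N] Sym_inv_inv[OF g])
    qed
    have "flat (insert {a, b, z} F) \<psi>"
      unfolding flat_def
    proof (intro allI impI)
      fix u v w assume "{u, v, w} \<in> insert {a, b, z} F"
      then consider "{u, v, w} \<in> F" | "{u, v, w} = {z, a, b}" by (auto simp: insert_commute)
      then show "\<psi> (u, v) \<circ> \<psi> (v, w) = \<psi> (u, w)"
      proof cases
        case 1
        then have "u \<noteq> v" "v \<noteq> w" "u \<noteq> w" using fin card_3_distinct by metis+
        then have sp: "spans F u v" "spans F v w" "spans F u w"
          using 1 by (auto simp: spans_def intro!: bexI[OF _ 1])
        have "\<phi> (u, w) = \<phi> (u, v) \<circ> \<phi> (v, w)" using \<phi>(1) 1 by (simp add: near_def flat_def)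
        then show ?thesis by (simp add: \<psi> sp comp_assoc Sym_inv_comp[OF g])
      next
        case 2
        show ?thesis
        proof (rule total_cochain_triangle[OF total' _ _ 2])
          have "\<psi> (a, b) = \<alpha> (a, b) \<circ> inv h"
            using step(2) dist by (simp add: \<psi> g_def \<phi>(2))
          moreover have "inv h = inv (\<alpha> (a, b)) \<circ> (inv (\<alpha> (z, a)) \<circ> inv (\<alpha> (b, z)))"
            by (simp add: h_def coboundary_def Sym_inv_o[of _ N] \<alpha>_Sym Sym_comp)
          ultimately show "\<psi> (z, a) \<circ> \<psi> (a, b) = \<psi> (z, b)"
            using \<alpha>_flip[of z b] by (simp add: \<psi>' zspan comp_assoc Sym_inv_comp[OF \<alpha>_Sym])
          show "card {z, a, b} = 3" using c by (simp add: insert_commute)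
        qed
      qed
    qed
    moreover have "d (\<alpha> (u, v)) (\<psi> (u, v)) \<le> sum defect (insert {a, b, z} F)" for u v
    proof (cases "spans F u v")
      case False
      then show ?thesis
        by (simp add: \<psi>' perm_dist_self N_pos sum_nonneg defect_nonneg)
    next
      case True
      have "d (\<alpha> (u, v)) (\<psi> (u, v)) \<le> d (\<alpha> (u, v)) (\<phi> (u, v)) + d (\<phi> (u, v)) (\<psi> (u, v))"
        by (rule perm_dist_triangle[OF N_pos])
      also have "\<dots> \<le> sum defect F + defect {a, b, z}"
      proof (rule add_mono)
        show "d (\<alpha> (u, v)) (\<phi> (u, v)) \<le> sum defect F" using \<phi>(1) by (simp add: near_def)
        have "u \<noteq> v" using True by (simp add: spans_def)
        \<comment> \<open>The gauge is trivial away from \<open>b\<close>. At \<open>b\<close> it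
          multiplies by \<open>h\<close> or its inverse, and invariance of the metric makes the cost
          the distance from \<open>h\<close> to the identity.\<close>
        consider "u = b" "v \<noteq> b" | "v = b" "u \<noteq> b" | "u \<noteq> b" "v \<noteq> b" using \<open>u \<noteq> v\<close> by blast
        then show "d (\<phi> (u, v)) (\<psi> (u, v)) \<le> defect {a, b, z}"
        proof cases
          case 1
          then have "d (\<phi> (u, v)) (\<psi> (u, v)) = d (id \<circ> \<phi> (u, v)) (h \<circ> \<phi> (u, v))"
            using \<psi>[OF True] by (simp add: g_def)
          also have "\<dots> = d h id" by (simp only: perm_dist_comp_right[OF S\<phi>] perm_dist_sym)
          finally show ?thesis using hd by simp
        next
          case 2
          then have "d (\<phi> (u, v)) (\<psi> (u, v)) = d (\<phi> (u, v) \<circ> id) (\<phi> (u, v) \<circ> inv h)"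
            using \<psi>[OF True] by (simp add: g_def)
          also have "\<dots> = d (inv id) (inv h)" by (simp only: perm_dist_comp_left[OF S\<phi>] inv_id)
          also have "\<dots> = d h id" using perm_dist_inv[OF Sym_id h] by (simp add: perm_dist_sym)
          finally show ?thesis using hd by simp
        next
          case 3
          then show ?thesis by (simp add: \<psi>[OF True] g_def perm_dist_self N_pos defect_nonneg)
        qed
      qed
      finally show ?thesis using fin t by simp
    qed
    ultimately have "near (insert {a, b, z} F) \<psi>"
      using total' \<psi>' by (auto simp: near_def spans_insert)
    then show ?thesis using 1 \<psi>' zspan by blast
  qed
qed

end

section \<open>Edges of a triangle and the chosen orientations\<close>

definition pairs :: "'a set \<Rightarrow> 'a set set" where
  "pairs t = {e. e \<subseteq> t \<and> card e = 2}"

lemma finite_pairs: "finite t \<Longrightarrow> finite (pairs t)"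
  by (rule finite_subset[of _ "Pow t"]) (auto simp: pairs_def)

lemma card_pairs: "card t = 3 \<Longrightarrow> card (pairs t) = 3"
  using n_subsets[of t 2] card_ge_0_finite[of t]
  by (simp add: pairs_def choose_two)

lemma pairs_triangle:
  assumes "card {x, y, z} = 3"
  shows "pairs {x, y, z} = {{x, y}, {y, z}, {z, x}}"
proof -
  have d: "x \<noteq> y" "y \<noteq> z" "x \<noteq> z" using assms by (auto simp: card_3_distinct)
  have "{{x, y}, {y, z}, {z, x}} \<subseteq> pairs {x, y, z}" using d by (auto simp: pairs_def)
  moreover have "card {{x, y}, {y, z}, {z, x}} = 3"
    using d by (simp add: card_3_distinct doubleton_eq_iff)
  ultimately show ?thesis
    using card_subset_eq[OF finite_pairs] card_pairs[OF assms] by (metis finite.intros)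
qed

lemma orient_edge_eq:
  assumes "card e = 2" "orient_edge e = (x, y)"
  shows "e = {x, y}" "x \<noteq> y"
proof -
  obtain a b where ab: "e = {a, b}" using assms(1) card_2_iff by metis
  have "\<exists>p. (\<lambda>(x, y). {x, y} = e) p" by (rule exI[of _ "(a, b)"]) (simp add: ab)
  from someI_ex[OF this] show "e = {x, y}" using assms(2) by (simp add: orient_edge_def)
  then show "x \<noteq> y" using assms(1) by auto
qed

lemma orient_triangle_eq:
  assumes "card t = 3" "orient_triangle t = (x, y, z)"
  shows "t = {x, y, z}"
proof -
  obtain a b c where abc: "t = {a, b, c}" using assms(1) card_3_iff by metis
  have "\<exists>p. (\<lambda>(x, y, z). {x, y, z} = t) p" by (rule exI[of _ "(a, b, c)"]) (simp add: abc)
  from someI_ex[OF this] show ?thesis using assms(2) by (simp add: orient_triangle_def)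
qed

context sym_cochain
begin

text \<open>The invariant is that \<open>F\<close> is a two-tree, or that one gluing step without a
  new vertex has been spent and a correction is already available. The vertex hypothesis forbids a
  second such step.\<close>

lemma edge_connected_near:
  assumes "edge_connected F"
    and "\<And>F'. F' \<subseteq> F \<Longrightarrow> edge_connected F' \<Longrightarrow> card F' < card (\<Union>F')"
  shows "\<exists>\<phi>. near F \<phi>"
proof -
  have "two_tree F \<or> card (\<Union>F) \<le> card F + 1 \<and> (\<exists>\<phi>. near F \<phi>)"
    using assms
  proof (induction rule: edge_connected.induct)
    case (base t)
    then show ?case by (simp add: two_tree.base)
  next
    case (step F a b z)
    note ec = step(1) and ab = step(2) and c = step(3) and t = step(4)
    have finF: "finite F" "\<forall>t\<in>F. card t = 3" using edge_connected_finite[OF ec] by auto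
    have IH: "two_tree F \<or> card (\<Union>F) \<le> card F + 1 \<and> (\<exists>\<phi>. near F \<phi>)"
      using step.IH step.prems by blast
    have card: "card (insert {a, b, z} F) = card F + 1" using finF t by simp
    have U: "\<Union>(insert {a, b, z} F) = insert z (\<Union>F)" using ab by (auto simp: spans_def)
    show ?case
    proof (cases "z \<in> \<Union>F")
      case False
      show ?thesis
      proof (cases "two_tree F")
        case True
        then show ?thesis using two_tree.step[OF _ ab False] by blast
      next
        case nt: False
        then obtain \<phi> where \<phi>: "near F \<phi>" and le: "card (\<Union>F) \<le> card F + 1" using IH by blast
        have nsp: "\<not> spans F b z" "\<not> spans F a z" using False by (auto simp: spans_def)
        \<comment> \<open>After the exception no vertex has to be prescribed: the apex is fresh, so
          only the move of \<open>ab\<close> enters the budget.\<close>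
        then have "\<phi> (a, z) = \<alpha> (a, z)" using \<phi> by (simp add: near_def)
        then have "d (\<alpha> (a, b)) (\<phi> (a, b)) + d (\<alpha> (a, z)) (\<phi> (a, z)) \<le> sum defect F"
          using \<phi> by (simp add: near_def perm_dist_self N_pos)
        then have "\<exists>\<phi>. near (insert {a, b, z} F) \<phi>"
          using near_extend[OF \<phi> finF c t nsp(1)] by blast
        moreover have "card (insert z (\<Union>F)) \<le> Suc (card (\<Union>F))"
          by (rule card_insert_le_m1) auto
        ultimately show ?thesis using le card U by simp
      qed
    next
      case True
      then have U': "\<Union>(insert {a, b, z} F) = \<Union>F" using U by auto
      \<comment> \<open>The step adds a triangle but no vertex, so the hypothesis for the enlarged
        family rules out the second alternative of the invariant.\<close>
      have "card F + 1 < card (\<Union>F)"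
        using step.prems[OF order_refl edge_connected.step[OF step(1-4)]] card U' by simp
      then have tt: "two_tree F" using IH by linarith
      have "\<exists>\<phi>. near (insert {a, b, z} F) \<phi>"
        if ab: "spans F a b" and c: "card {a, b, z} = 3" and t: "{a, b, z} \<notin> F"
          and new: "\<not> spans F b z" for a b
      proof -
        have "a \<in> \<Union>F" using ab by (auto simp: spans_def)
        \<comment> \<open>Fixing all values at \<open>a\<close> makes both \<open>ab\<close> and
          \<open>az\<close> unmoved, although \<open>az\<close> may already be an edge of
          \<open>F\<close>.\<close>
        then obtain \<phi> where \<phi>: "near F \<phi>" "\<And>y. \<phi> (a, y) = \<alpha> (a, y)"
          using two_tree_near[OF tt] by blast
        have "d (\<alpha> (a, b)) (\<phi> (a, b)) + d (\<alpha> (a, z)) (\<phi> (a, z)) \<le> sum defect F"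
          by (simp add: \<phi>(2) perm_dist_self N_pos sum_nonneg defect_nonneg)
        then show ?thesis using near_extend[OF \<phi>(1) finF c t new] by blast
      qed
      \<comment> \<open>By \<open>two_tree_clique\<close>, \<open>az\<close> and \<open>bz\<close>
        are not both edges of \<open>F\<close>, since the new triangle is not in \<open>F\<close>;
        the roles of \<open>a\<close> and \<open>b\<close> are chosen accordingly.\<close>
      from this[of a b] this[of b a] have "\<exists>\<phi>. near (insert {a, b, z} F) \<phi>"
        using ab c t spans_sym[of F] two_tree_clique[OF tt ab, of z]
        by (auto simp: insert_commute)
      moreover have "card (\<Union>F) = card F + 2" using two_tree_card tt by blast
      ultimately show ?thesis using card U' by simp
    qed
  qed
  moreover have "\<exists>\<phi>. near F \<phi>" if tt: "two_tree F"
  proof -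
    have "card (\<Union>F) \<noteq> 0" using two_tree_card[OF tt] by linarith
    then obtain x where "x \<in> \<Union>F" by (metis card.empty equals0I)
    then show ?thesis using two_tree_near[OF tt] by blast
  qed
  ultimately show ?thesis by blast
qed

definition edge_cost :: "'a cochain \<Rightarrow> 'a set \<Rightarrow> real" where
  "edge_cost \<phi> e = d (\<alpha> (orient_edge e)) (\<phi> (orient_edge e))"

text \<open>A maximal edge-connected set of triangles shares no edge with the remaining triangles,
  so cocycles on the two parts can be combined.\<close>

lemma flat_cochain_near:
  assumes "finite T" "\<And>t. t \<in> T \<Longrightarrow> card t = 3"
    and "\<And>F. F \<subseteq> T \<Longrightarrow> edge_connected F \<Longrightarrow> real (card F) \<le> m \<and> card F < card (\<Union>F)"
  shows "\<exists>\<phi>. total_cochain N \<phi> \<and> flat T \<phi>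
     \<and> (\<Sum>t\<in>T. \<Sum>e\<in>pairs t. edge_cost \<phi> e) \<le> 3 * m * sum defect T"
  using assms
proof (induction rule: finite_psubset_induct)
  case (psubset T)
  show ?case
  proof (cases "T = {}")
    case True
    then show ?thesis using total by (auto simp: flat_def)
  next
    case False
    then obtain t0 where "t0 \<in> T" by blast
    then have "edge_connected {t0}" "{t0} \<subseteq> T" using psubset.prems(1) edge_connected.base by auto
    moreover have "card F \<le> card T" if "F \<subseteq> T" for F
      using that psubset.hyps card_mono by blast
    \<comment> \<open>A family of largest size suffices as a component: it cannot be enlarged by one
      triangle.\<close>
    ultimately obtain F where F: "F \<subseteq> T" "edge_connected F"
      and max: "\<And>G. G \<subseteq> T \<Longrightarrow> edge_connected G \<Longrightarrow> card G \<le> card F"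
      using ex_has_greatest_nat[of "\<lambda>F. F \<subseteq> T \<and> edge_connected F" "{t0}" card "Suc (card T)"]
      by (auto simp: less_Suc_eq_le)
    note finF = edge_connected_finite[OF F(2)]
    have sep: "\<not> spans F x y" if t: "t \<in> T - F" "{x, y} \<subseteq> t" for t x y
    proof
      assume sp: "spans F x y"
      have c: "card t = 3" using t psubset.prems(1) by blast
      have "card (t - {x, y}) = 1"
        using c t(2) sp by (subst card_Diff_subset) (auto simp: spans_def)
      then obtain z where "t - {x, y} = {z}" by (auto simp: card_1_singleton_iff)
      then have tz: "t = {x, y, z}" using t(2) by auto
      have "edge_connected (insert {x, y, z} F)"
        using edge_connected.step[OF F(2) sp] c t(1) tz by auto
      then have "card (insert {x, y, z} F) \<le> card F" using max F(1) t tz by auto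
      then show False using finF t(1) tz by auto
    qed
    have "T - F \<subset> T" using F finF by blast
    then have "\<exists>\<phi>. total_cochain N \<phi> \<and> flat (T - F) \<phi>
        \<and> (\<Sum>t\<in>T-F. \<Sum>e\<in>pairs t. edge_cost \<phi> e) \<le> 3 * m * sum defect (T - F)"
      by (rule psubset.IH) (blast intro: psubset.prems(1), use psubset.prems(2) in blast)
    then obtain \<phi>1 where \<phi>1: "total_cochain N \<phi>1" "flat (T - F) \<phi>1"
        "(\<Sum>t\<in>T-F. \<Sum>e\<in>pairs t. edge_cost \<phi>1 e) \<le> 3 * m * sum defect (T - F)"
      by blast
    obtain \<phi>2 where \<phi>2: "near F \<phi>2"
      using edge_connected_near[OF F(2)] psubset.prems(2) F(1) by blast
    \<comment> \<open>By \<open>sep\<close>, every triangle of \<open>T\<close> has either all its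
      edges or none among the edges of \<open>F\<close>, so no triangle mixes the two
      cochains.\<close>
    define \<phi> where "\<phi> = (\<lambda>(x, y). if spans F x y then \<phi>2 (x, y) else \<phi>1 (x, y))"
    have on: "\<phi> (x, y) = \<phi>2 (x, y)" if "spans F x y" for x y using that by (simp add: \<phi>_def)
    have off: "\<phi> (x, y) = \<phi>1 (x, y)" if "\<not> spans F x y" for x y using that by (simp add: \<phi>_def)
    have t2: "total_cochain N \<phi>2" "flat F \<phi>2" using \<phi>2 by (auto simp: near_def)
    have "total_cochain N \<phi>"
      unfolding total_cochain_def
      using total_cochainD[OF t2(1)] total_cochainD[OF \<phi>1(1)] on off spans_sym[of F] by metis
    moreover have "flat T \<phi>"
      unfolding flat_def
    proof (intro allI impI)
      fix x y z assume xyz: "{x, y, z} \<in> T"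
      then have d: "x \<noteq> y" "y \<noteq> z" "x \<noteq> z" using psubset.prems(1) card_3_distinct by metis+
      show "\<phi> (x, y) \<circ> \<phi> (y, z) = \<phi> (x, z)"
      proof (cases "{x, y, z} \<in> F")
        case True
        then have "spans F x y" "spans F y z" "spans F x z"
          using d by (auto simp: spans_def intro!: bexI[OF _ True])
        then show ?thesis using t2(2) True by (simp add: on flat_def)
      next
        case False
        then have "\<not> spans F x y" "\<not> spans F y z" "\<not> spans F x z"
          using xyz sep[of "{x, y, z}"] by auto
        then show ?thesis using \<phi>1(2) False xyz by (simp add: off flat_def)
      qed
    qed
    moreover have "(\<Sum>t\<in>T. \<Sum>e\<in>pairs t. edge_cost \<phi> e) \<le> 3 * m * sum defect T"
    proof -
      have "(\<Sum>e\<in>pairs t. edge_cost \<phi> e) \<le> 3 * sum defect F" if t: "t \<in> F" for t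
      proof -
        have "edge_cost \<phi> e \<le> sum defect F" if e: "e \<in> pairs t" for e
        proof -
          obtain x y where xy: "orient_edge e = (x, y)" by fastforce
          have "card e = 2" "e \<subseteq> t" using e by (auto simp: pairs_def)
          then have "spans F x y"
            using orient_edge_eq[OF _ xy] t unfolding spans_def by blast
          then show ?thesis using \<phi>2 by (simp add: edge_cost_def xy on near_def)
        qed
        then have "(\<Sum>e\<in>pairs t. edge_cost \<phi> e) \<le> real (card (pairs t)) * sum defect F"
          by (rule sum_bounded_above)
        moreover have "card (pairs t) = 3" using card_pairs finF t by blast
        ultimately show ?thesis by simp
      qed
      \<comment> \<open>Each of the \<open>3 * card F\<close> incidences costs at most the total
        defect of \<open>F\<close>; this is where the size bound \<open>m\<close> becomes the
        multiplicative loss.\<close>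
      then have "(\<Sum>t\<in>F. \<Sum>e\<in>pairs t. edge_cost \<phi> e) \<le> real (card F) * (3 * sum defect F)"
        by (rule sum_bounded_above)
      also have "\<dots> \<le> m * (3 * sum defect F)"
        using psubset.prems(2)[OF F] by (intro mult_right_mono) (auto simp: sum_nonneg defect_nonneg)
      finally have 1: "(\<Sum>t\<in>F. \<Sum>e\<in>pairs t. edge_cost \<phi> e) \<le> 3 * m * sum defect F" by simp
      have eq: "edge_cost \<phi> e = edge_cost \<phi>1 e" if "t \<in> T - F" "e \<in> pairs t" for t e
      proof -
        obtain x y where xy: "orient_edge e = (x, y)" by fastforce
        then have "e = {x, y}" using orient_edge_eq(1)[OF _ xy] that(2) unfolding pairs_def by blast
        then have "\<not> spans F x y" using sep[OF that(1)] that(2) by (simp add: pairs_def)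
        then show ?thesis by (simp add: edge_cost_def xy off)
      qed
      have "(\<Sum>t\<in>T-F. \<Sum>e\<in>pairs t. edge_cost \<phi> e) = (\<Sum>t\<in>T-F. \<Sum>e\<in>pairs t. edge_cost \<phi>1 e)"
        using eq by (intro sum.cong refl) blast
      then have 2: "(\<Sum>t\<in>T-F. \<Sum>e\<in>pairs t. edge_cost \<phi> e) \<le> 3 * m * sum defect (T - F)"
        using \<phi>1(3) by simp
      show ?thesis
        using 1 2 sum.subset_diff[OF F(1) psubset.hyps, of "\<lambda>t. \<Sum>e\<in>pairs t. edge_cost \<phi> e"]
          sum.subset_diff[OF F(1) psubset.hyps, of defect]
        by (simp add: algebra_simps)
    qed
    ultimately show ?thesis by blast
  qed
qed

end

section \<open>Deterministic bounds on the Cheeger constant\<close>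

locale two_complex =
  fixes Y :: "'a set set"
  assumes fin: "finite Y" and closed: "t \<in> triangles Y \<Longrightarrow> pairs t \<subseteq> Y"
begin

lemma fin_tri: "finite (triangles Y)" and fin_edges: "finite (edges Y)"
  using fin by (auto simp: triangles_def edges_def)

lemma tri_card: "t \<in> triangles Y \<Longrightarrow> card t = 3"
  by (simp add: triangles_def)

lemma pairs_edges: "t \<in> triangles Y \<Longrightarrow> pairs t = {e \<in> edges Y. e \<subseteq> t}"
  using closed by (auto simp: pairs_def edges_def)

lemma orient_edge_oriented: "e \<in> edges Y \<Longrightarrow> orient_edge e \<in> oriented_edges Y"
proof -
  assume e: "e \<in> edges Y"
  obtain x y where xy: "orient_edge e = (x, y)" by fastforce
  have "e = {x, y}" using orient_edge_eq(1)[OF _ xy] e by (simp add: edges_def)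
  then have "{x, y} \<in> edges Y" using e by simp
  then show ?thesis by (simp add: xy oriented_edges_def)
qed

lemma triangle_oriented_edges:
  assumes "{x, y, z} \<in> triangles Y"
  shows "(x, y) \<in> oriented_edges Y" "(y, z) \<in> oriented_edges Y" "(z, x) \<in> oriented_edges Y"
proof -
  have "{{x, y}, {y, z}, {z, x}} \<subseteq> edges Y"
    using pairs_edges[OF assms] pairs_triangle[OF tri_card[OF assms]] by auto
  then show "(x, y) \<in> oriented_edges Y" "(y, z) \<in> oriented_edges Y" "(z, x) \<in> oriented_edges Y"
    by (auto simp: oriented_edges_def)
qed

text \<open>Counting incidences of edges and triangles replaces the weights of \<open>mu1\<close> by
  a sum over triangles, the form in which components are estimated.\<close>

lemma double_count:
  fixes c :: "'a set \<Rightarrow> real"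
  shows "(\<Sum>e\<in>edges Y. real (card {t \<in> triangles Y. e \<subseteq> t}) * c e)
    = (\<Sum>t\<in>triangles Y. \<Sum>e\<in>pairs t. c e)"
proof -
  have "(\<Sum>e\<in>edges Y. real (card {t \<in> triangles Y. e \<subseteq> t}) * c e)
      = (\<Sum>e\<in>edges Y. \<Sum>t\<in>triangles Y. if e \<subseteq> t then c e else 0)"
    using fin_tri by (simp add: sum.inter_filter[symmetric])
  also have "\<dots> = (\<Sum>t\<in>triangles Y. \<Sum>e\<in>edges Y. if e \<subseteq> t then c e else 0)"
    by (rule sum.swap)
  also have "\<dots> = (\<Sum>t\<in>triangles Y. \<Sum>e\<in>pairs t. c e)"
    by (rule sum.cong[OF refl]) (simp only: pairs_edges sum.inter_filter[OF fin_edges])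
  finally show ?thesis .
qed

lemma cochain_dist_eq:
  "cochain_dist Y (m, \<alpha>) (N, \<beta>) = (\<Sum>t\<in>triangles Y. \<Sum>e\<in>pairs t.
     perm_dist m (\<alpha> (orient_edge e)) N (\<beta> (orient_edge e))) / (3 * real (card (triangles Y)))"
proof -
  \<comment> \<open>The normalisation of \<open>mu1\<close>: every triangle contributes its three
    edges.\<close>
  have "(\<Sum>e\<in>edges Y. real (card {t \<in> triangles Y. e \<subseteq> t})) = 3 * real (card (triangles Y))"
    using double_count[of "\<lambda>_. 1"] by (simp add: card_pairs tri_card)
  then show ?thesis
    by (simp add: cochain_dist_def mu1_def double_count[symmetric] sum_divide_distrib)
qed

lemma coboundary_norm_eq:
  "coboundary_norm Y (N, \<alpha>) = (\<Sum>t\<in>triangles Y.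
     perm_dist N (coboundary \<alpha> (orient_triangle t)) N id) / real (card (triangles Y))"
  by (simp add: coboundary_norm_def mu2_def sum_divide_distrib)

lemma coboundary_norm_nonneg: "0 \<le> coboundary_norm Y a"
  by (cases a) (simp add: coboundary_norm_eq sum_nonneg perm_dist_nonneg)

lemma cochain_dist_nonneg: "0 \<le> cochain_dist Y a b"
  by (cases a; cases b) (simp add: cochain_dist_eq sum_nonneg perm_dist_nonneg)

section \<open>Passage between cochains of the complex and total cochains\<close>

definition extend :: "'a cochain \<Rightarrow> 'a cochain" where
  "extend \<alpha> = (\<lambda>e. if e \<in> oriented_edges Y then \<alpha> e else id)"

lemma oriented_edges_sym: "(x, y) \<in> oriented_edges Y \<longleftrightarrow> (y, x) \<in> oriented_edges Y"
  by (simp add: oriented_edges_def insert_commute)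

lemma sym_cochain_extend:
  assumes "\<alpha> \<in> cochains Y N" "N > 0"
  shows "sym_cochain N (extend \<alpha>)"
proof
  have "extend \<alpha> (x, y) \<in> Sym N \<and> extend \<alpha> (y, x) = inv (extend \<alpha> (x, y))" for x y
  proof (cases "(x, y) \<in> oriented_edges Y")
    case True
    then have "\<alpha> (x, y) \<in> Sym N" "\<alpha> (y, x) = inv (\<alpha> (x, y))"
      using assms(1) unfolding cochains_def by blast+
    then show ?thesis using True oriented_edges_sym[of x y] by (simp only: extend_def if_True)
  next
    case False
    then show ?thesis using oriented_edges_sym[of x y] by (simp add: extend_def Sym_id)
  qed
  then show "total_cochain N (extend \<alpha>)" unfolding total_cochain_def by blast
qed fact

lemma coboundary_extend:
  assumes "t \<in> triangles Y"
  shows "coboundary (extend \<alpha>) (orient_triangle t) = coboundary \<alpha> (orient_triangle t)"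
proof -
  obtain x y z where o: "orient_triangle t = (x, y, z)" by (metis prod_cases3)
  then have "{x, y, z} \<in> triangles Y" using orient_triangle_eq assms tri_card by metis
  then show ?thesis
    using triangle_oriented_edges by (simp add: o coboundary_def extend_def)
qed

lemma restrict_cochain:
  assumes "total_cochain N \<phi>"
  shows "restrict \<phi> (oriented_edges Y) \<in> cochains Y N"
  unfolding cochains_def
proof (intro CollectI conjI ballI)
  note S = total_cochainD[OF assms]
  show "restrict \<phi> (oriented_edges Y) \<in> oriented_edges Y \<rightarrow>\<^sub>E Sym N"
    using S(1) by (metis PiE_restrict restrict_PiE_iff surj_pair)
  fix p assume "p \<in> oriented_edges Y"
  then show "case p of (x, y) \<Rightarrow> restrict \<phi> (oriented_edges Y) (y, x)
      = inv (restrict \<phi> (oriented_edges Y) (x, y))"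
    using S(2)[of "snd p" "fst p"] oriented_edges_sym[of "fst p" "snd p"]
    by (simp add: case_prod_beta)
qed

lemma restrict_cocycle:
  assumes \<phi>: "total_cochain N \<phi>" and flat: "flat (triangles Y) \<phi>"
  shows "restrict \<phi> (oriented_edges Y) \<in> cocycles Y N"
proof -
  note S = total_cochainD[OF \<phi>]
  note restrict_cochain[OF \<phi>]
  moreover have "coboundary (restrict \<phi> (oriented_edges Y)) (x, y, z) = id"
    if "{x, y, z} \<in> triangles Y" for x y z
  proof -
    have "\<phi> (x, y) \<circ> \<phi> (y, z) = \<phi> (x, z)" using flat that by (simp add: flat_def)
    then show ?thesis
      using triangle_oriented_edges[OF that] S(2)[of z x] Sym_inv_comp[OF S(1)]
      by (simp add: coboundary_def)
  qed
  ultimately show ?thesis by (auto simp: cocycles_def oriented_triangles_def)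
qed

text \<open>The trivial cocycle. \<open>dist_Z1\<close> is a real infimum, so bounding it from below
  requires a nonempty index set.\<close>

lemma Z1_nonempty: "Z1 Y \<noteq> {}"
proof -
  have "restrict (\<lambda>_. id) (oriented_edges Y) \<in> cocycles Y 2"
    by (rule restrict_cocycle) (auto simp: total_cochain_def Sym_id flat_def)
  then show ?thesis by (auto simp: Z1_def)
qed

text \<open>The corrected cochain is a cocycle of the same degree. Its incidence cost
  \<open>3 * m\<close> times the total defect, divided by the normalisation, bounds the distance to
  cocycles by \<open>m\<close> times the coboundary norm.\<close>

theorem h1_ge:
  assumes m: "m > 0"
    and ec: "\<And>F. F \<subseteq> triangles Y \<Longrightarrow> edge_connected F
      \<Longrightarrow> real (card F) \<le> m \<and> card F < card (\<Union>F)"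
  shows "ereal (1 / m) \<le> h1 Y"
proof -
  have "ereal (1 / m) \<le> ereal (coboundary_norm Y a) / ereal (dist_Z1 Y a)"
    if a: "a \<in> C1 Y" "coboundary_norm Y a \<noteq> 0" for a
  proof -
    obtain N \<alpha> where N: "a = (N, \<alpha>)" "N \<ge> 2" "\<alpha> \<in> cochains Y N"
      using a(1) by (auto simp: C1_def)
    interpret sym_cochain N "extend \<alpha>" using sym_cochain_extend N by simp
    obtain \<phi> where \<phi>: "total_cochain N \<phi>" "flat (triangles Y) \<phi>"
      and le: "(\<Sum>t\<in>triangles Y. \<Sum>e\<in>pairs t. edge_cost \<phi> e) \<le> 3 * m * sum defect (triangles Y)"
      using flat_cochain_near[OF fin_tri tri_card ec] by blast
    define \<beta> where "\<beta> = restrict \<phi> (oriented_edges Y)"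
    have Z: "(N, \<beta>) \<in> Z1 Y" using restrict_cocycle[OF \<phi>] N by (simp add: \<beta>_def Z1_def)
    have "dist_Z1 Y a \<le> cochain_dist Y a (N, \<beta>)"
      unfolding dist_Z1_def by (rule cINF_lower[OF _ Z]) (auto intro!: bdd_belowI2 cochain_dist_nonneg)
    also have "\<dots> = (\<Sum>t\<in>triangles Y. \<Sum>e\<in>pairs t. edge_cost \<phi> e) / (3 * real (card (triangles Y)))"
    proof -
      have "perm_dist N (\<alpha> (orient_edge e)) N (\<beta> (orient_edge e)) = edge_cost \<phi> e"
        if "t \<in> triangles Y" "e \<in> pairs t" for t e
      proof -
        have "orient_edge e \<in> oriented_edges Y" using that orient_edge_oriented pairs_edges by blast
        then show ?thesis unfolding edge_cost_def by (simp add: extend_def \<beta>_def)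
      qed
      then show ?thesis unfolding N(1) cochain_dist_eq by (simp cong: sum.cong)
    qed
    also have "\<dots> \<le> (3 * m * sum defect (triangles Y)) / (3 * real (card (triangles Y)))"
      by (rule divide_right_mono[OF le]) simp
    also have "\<dots> = m * coboundary_norm Y a"
      by (simp add: N(1) coboundary_norm_eq defect_def coboundary_extend)
    finally have le: "dist_Z1 Y a \<le> m * coboundary_norm Y a" .
    have pos: "coboundary_norm Y a > 0" using a(2) coboundary_norm_nonneg[of a] by linarith
    have "dist_Z1 Y a \<ge> 0"
      unfolding dist_Z1_def by (rule cINF_greatest[OF Z1_nonempty cochain_dist_nonneg])
    then consider "dist_Z1 Y a = 0" | "dist_Z1 Y a > 0" by linarith
    then show ?thesis
    proof cases
      case 2
      then show ?thesis using le m by (simp add: field_simps)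
    next
      \<comment> \<open>A nonzero coboundary norm over distance zero is infinite in the extended
        reals.\<close>
      case 1
      then show ?thesis using pos by (subst ereal_divide) simp
    qed
  qed
  then show ?thesis
    unfolding h1_def by (cases "triangles Y = {}") (simp, simp only: if_False, rule INF_greatest, blast)
qed

text \<open>On a triangle the defect is at most the sum of three edge distances, and the factor 3 is
  the normalisation of \<open>mu1\<close>. The cocycle may have any degree, hence the use of
  \<open>perm_dist_triple_le\<close>.\<close>

lemma coboundary_norm_le:
  assumes a: "a \<in> C1 Y" and Z: "\<phi> \<in> Z1 Y"
  shows "coboundary_norm Y a \<le> 3 * cochain_dist Y a \<phi>"
proof -
  obtain m \<alpha> where A: "a = (m, \<alpha>)" "m \<ge> 2" "\<alpha> \<in> cochains Y m" using a by (auto simp: C1_def)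
  obtain N \<beta> where B: "\<phi> = (N, \<beta>)" "\<beta> \<in> cocycles Y N" using Z by (auto simp: Z1_def)
  then have B': "\<beta> \<in> cochains Y N" by (simp add: cocycles_def)
  let ?c = "\<lambda>e. perm_dist m (\<alpha> (orient_edge e)) N (\<beta> (orient_edge e))"
  have "perm_dist m (coboundary \<alpha> (orient_triangle t)) m id \<le> (\<Sum>e\<in>pairs t. ?c e)"
    if t: "t \<in> triangles Y" for t
  proof -
    obtain x y z where o: "orient_triangle t = (x, y, z)" by (metis prod_cases3)
    then have xyz: "t = {x, y, z}" using orient_triangle_eq t tri_card by metis
    then have c: "card {x, y, z} = 3" using t tri_card by blast
    then have dist: "x \<noteq> y" "y \<noteq> z" "x \<noteq> z" by (auto simp: card_3_distinct)
    note oe = triangle_oriented_edges[OF t[unfolded xyz]]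
    have mem: "\<alpha> e \<in> Sym m" "\<beta> e \<in> Sym N" if "e \<in> oriented_edges Y" for e
      using that A(3) B' by (auto simp: cochains_def)
    have "(x, y, z) \<in> oriented_triangles Y" using t xyz by (simp add: oriented_triangles_def)
    then have "\<beta> (x, y) \<circ> \<beta> (y, z) \<circ> \<beta> (z, x) = id"
      using B(2) by (auto simp: cocycles_def coboundary_def)
    then have "perm_dist m (\<alpha> (x, y) \<circ> \<alpha> (y, z) \<circ> \<alpha> (z, x)) m id
       \<le> perm_dist m (\<alpha> (x, y)) N (\<beta> (x, y)) + perm_dist m (\<alpha> (y, z)) N (\<beta> (y, z))
         + perm_dist m (\<alpha> (z, x)) N (\<beta> (z, x))"
      using A(2) by (intro perm_dist_triple_le mem oe) auto
    \<comment> \<open>The chosen orientation of an edge may run against the triangle;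
      \<open>perm_dist_swap\<close> absorbs this.\<close>
    moreover have "perm_dist m (\<alpha> (u, v)) N (\<beta> (u, v)) = ?c {u, v}"
      if uv: "(u, v) \<in> oriented_edges Y" for u v
    proof -
      obtain p q where pq: "orient_edge {u, v} = (p, q)" by fastforce
      have "card {u, v} = 2" using uv by (simp add: oriented_edges_def edges_def)
      from orient_edge_eq(1)[OF this pq] have "p = u \<and> q = v \<or> p = v \<and> q = u"
        by (auto simp: doubleton_eq_iff)
      then show ?thesis using perm_dist_swap[OF A(3) B' uv] pq by auto
    qed
    ultimately show ?thesis
      using dist oe unfolding xyz pairs_triangle[OF c]
      by (simp add: o[unfolded xyz] coboundary_def doubleton_eq_iff)
  qed
  then have "(\<Sum>t\<in>triangles Y. perm_dist m (coboundary \<alpha> (orient_triangle t)) m id)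
      \<le> (\<Sum>t\<in>triangles Y. \<Sum>e\<in>pairs t. ?c e)"
    by (rule sum_mono)
  then show ?thesis
    by (simp add: A(1) B(1) coboundary_norm_eq cochain_dist_eq divide_right_mono)
qed

text \<open>Put a transposition on one edge of the triangle and the identity elsewhere. This makes
  the infimum defining \<open>h1\<close> range over a nonempty set.\<close>

lemma nonflat_cochain:
  assumes "t \<in> triangles Y"
  shows "\<exists>a\<in>C1 Y. coboundary_norm Y a \<noteq> 0"
proof -
  obtain x y z where xyz: "t = {x, y, z}" using tri_card[OF assms] card_3_iff by metis
  have c: "card {x, y, z} = 3" using tri_card[OF assms] xyz by simp
  then have dist: "x \<noteq> y" "y \<noteq> z" "x \<noteq> z" by (auto simp: card_3_distinct)
  let ?\<tau> = "Transposition.transpose (1::nat) 2"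
  define \<alpha>0 where "\<alpha>0 = (\<lambda>e. if e = (x, y) \<or> e = (y, x) then ?\<tau> else id)"
  define \<alpha> where "\<alpha> = restrict \<alpha>0 (oriented_edges Y)"
  have \<tau>: "?\<tau> \<in> Sym 2" by (simp add: Sym_def permutes_swap_id)
  have "\<alpha>0 p \<in> Sym 2" "\<alpha>0 (v, u) = inv (\<alpha>0 (u, v))" for p u v
    using \<tau> by (auto simp: \<alpha>0_def Sym_id)
  then have "total_cochain 2 \<alpha>0" unfolding total_cochain_def by blast
  then have "\<alpha> \<in> cochains Y 2" unfolding \<alpha>_def by (rule restrict_cochain)
  then have A: "(2, \<alpha>) \<in> C1 Y" by (simp add: C1_def)
  interpret sym_cochain 2 "extend \<alpha>" using sym_cochain_extend \<open>\<alpha> \<in> _\<close> by simp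
  have "coboundary (extend \<alpha>) (x, y, z) = ?\<tau>"
    using triangle_oriented_edges[of x y z] assms xyz dist
    by (simp add: coboundary_def extend_def \<alpha>_def \<alpha>0_def)
  then have "defect t = perm_dist 2 ?\<tau> 2 id" using defect_eq[OF c] xyz by simp
  also have "\<dots> > 0"
  proof -
    have "1 \<in> {i \<in> {1..2}. ?\<tau> i \<noteq> id i}" by simp
    then have "card {i \<in> {1..2}. ?\<tau> i \<noteq> id i} > 0"
      by (subst card_gt_0_iff) (blast intro: finite_subset[of _ "{1..2}"])
    then show ?thesis by (subst perm_dist_eq_count) simp_all
  qed
  finally have "0 < sum defect (triangles Y)"
    using assms fin_tri by (intro sum_pos2[OF _ assms] defect_nonneg) auto
  moreover have "card (triangles Y) > 0" using assms fin_tri card_gt_0_iff by blast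
  ultimately have "coboundary_norm Y (2, \<alpha>) \<noteq> 0"
    by (simp add: coboundary_norm_eq defect_def coboundary_extend)
  then show ?thesis using A by blast
qed

theorem h1_le_3:
  assumes "triangles Y \<noteq> {}"
  shows "h1 Y \<le> 3"
proof -
  obtain a where a: "a \<in> C1 Y" "coboundary_norm Y a \<noteq> 0" using assms nonflat_cochain by blast
  then have pos: "coboundary_norm Y a > 0" using coboundary_norm_nonneg[of a] by linarith
  have "coboundary_norm Y a / 3 \<le> dist_Z1 Y a"
    unfolding dist_Z1_def
  proof (rule cINF_greatest[OF Z1_nonempty])
    fix \<phi> assume "\<phi> \<in> Z1 Y"
    then show "coboundary_norm Y a / 3 \<le> cochain_dist Y a \<phi>"
      using coboundary_norm_le[OF a(1)] by fastforce
  qed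
  \<comment> \<open>Positivity excludes division by zero, so the quotient is a finite real.\<close>
  moreover from this have "dist_Z1 Y a > 0" using pos by linarith
  ultimately have "ereal (coboundary_norm Y a) / ereal (dist_Z1 Y a) \<le> ereal 3"
    by (simp add: pos_divide_le_eq)
  moreover have "h1 Y \<le> ereal (coboundary_norm Y a) / ereal (dist_Z1 Y a)"
    unfolding h1_def if_not_P[OF assms] by (rule INF_lower) (use a in blast)
  ultimately have "h1 Y \<le> ereal 3" by (rule order_trans[rotated])
  then show ?thesis by simp
qed

end

section \<open>The random complex\<close>

definition all_triangles :: "nat \<Rightarrow> nat set set" where
  "all_triangles n = {t. t \<subseteq> {1..n} \<and> card t = 3}"

lemma finite_all_triangles: "finite (all_triangles n)"
  by (rule finite_subset[of _ "Pow {1..n}"]) (auto simp: all_triangles_def)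

lemma card_all_triangles: "card (all_triangles n) = n choose 3"
  using n_subsets[of "{1..n}" 3] by (simp add: all_triangles_def)

definition lm_complex :: "nat \<Rightarrow> (nat set \<Rightarrow> bool) \<Rightarrow> nat set set" where
  "lm_complex n f = {s. s \<subseteq> {1..n} \<and> (card s = 1 \<or> card s = 2)} \<union> {t \<in> all_triangles n. f t}"

lemma linial_meshulam_eq:
  "linial_meshulam n p
     = map_pmf (lm_complex n) (Pi_pmf (all_triangles n) False (\<lambda>_. bernoulli_pmf p))"
proof -
  have "lm_complex n = (\<lambda>f. {s. s \<subseteq> {1..n} \<and> (card s = 1 \<or> card s = 2)} \<union>
      {t. t \<subseteq> {1..n} \<and> card t = 3 \<and> f t})"
    by (intro ext) (auto simp: lm_complex_def all_triangles_def)
  then show ?thesis by (simp add: linial_meshulam_def all_triangles_def)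
qed

lemma triangles_lm_complex: "triangles (lm_complex n f) = {t \<in> all_triangles n. f t}"
  by (auto simp: triangles_def lm_complex_def all_triangles_def)

lemma two_complex_lm_complex: "two_complex (lm_complex n f)"
proof
  show "finite (lm_complex n f)"
    by (rule finite_subset[of _ "Pow {1..n}"]) (auto simp: lm_complex_def all_triangles_def)
  show "pairs t \<subseteq> lm_complex n f" if "t \<in> triangles (lm_complex n f)" for t
    using that unfolding triangles_lm_complex by (auto simp: lm_complex_def all_triangles_def pairs_def)
qed

lemma set_linial_meshulam: "Y \<in> set_pmf (linial_meshulam n p) \<Longrightarrow> \<exists>f. Y = lm_complex n f"
  by (auto simp: linial_meshulam_eq)

lemma prob_superset:
  assumes p: "0 \<le> p" "p \<le> 1" and F: "F \<subseteq> all_triangles n"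
  shows "measure_pmf.prob (linial_meshulam n p) {Y. F \<subseteq> triangles Y} = p ^ card F"
proof -
  \<comment> \<open>Both this event and the absence of triangles constrain coordinates separately,
    so independence gives a product.\<close>
  have "lm_complex n -` {Y. F \<subseteq> triangles Y}
      = Pi (all_triangles n) (\<lambda>t. if t \<in> F then {True} else UNIV)"
    using F by (auto simp: triangles_lm_complex Pi_def)
  then have "measure_pmf.prob (linial_meshulam n p) {Y. F \<subseteq> triangles Y}
      = (\<Prod>t\<in>all_triangles n. measure_pmf.prob (bernoulli_pmf p) (if t \<in> F then {True} else UNIV))"
    by (simp add: linial_meshulam_eq measure_Pi_pmf_Pi finite_all_triangles)
  also have "\<dots> = (\<Prod>t\<in>all_triangles n. if t \<in> F then p else 1)"
    using p by (intro prod.cong refl) (simp add: measure_pmf_single)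
  also have "\<dots> = p ^ card F"
    using F finite_all_triangles by (simp add: prod.If_cases Int_absorb1)
  finally show ?thesis .
qed

lemma prob_no_triangles:
  assumes p: "0 \<le> p" "p \<le> 1"
  shows "measure_pmf.prob (linial_meshulam n p) {Y. triangles Y = {}} = (1 - p) ^ (n choose 3)"
proof -
  have "lm_complex n -` {Y. triangles Y = {}} = Pi (all_triangles n) (\<lambda>t. {False})"
    by (auto simp: triangles_lm_complex Pi_def)
  then have "measure_pmf.prob (linial_meshulam n p) {Y. triangles Y = {}}
      = (\<Prod>t\<in>all_triangles n. measure_pmf.prob (bernoulli_pmf p) {False})"
    by (simp add: linial_meshulam_eq measure_Pi_pmf_Pi finite_all_triangles)
  also have "\<dots> = (1 - p) ^ (n choose 3)"
    using p by (simp add: measure_pmf_single card_all_triangles)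
  finally show ?thesis .
qed

section \<open>First moment bounds by numbers of triangles and vertices\<close>

definition contains_type :: "nat \<Rightarrow> nat \<Rightarrow> 'a set set \<Rightarrow> bool" where
  "contains_type f v Y \<longleftrightarrow> (\<exists>F\<subseteq>triangles Y. card F = f \<and> card (\<Union>F) = v)"

text \<open>Choose the \<open>v\<close> vertices, then any family of subsets of them. The crude
  constant is harmless because \<open>v\<close> stays fixed while \<open>n\<close> grows.\<close>

lemma card_type_le:
  "card {F. F \<subseteq> all_triangles n \<and> card F = f \<and> card (\<Union>F) = v} \<le> 2 ^ (2 ^ v) * n ^ v"
proof -
  let ?W = "{W. W \<subseteq> {1..n} \<and> card W = v}"
  have finW: "finite ?W" by (rule finite_subset[of _ "Pow {1..n}"]) auto
  have fin: "finite W" if "W \<in> ?W" for W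
    by (rule finite_subset[of _ "{1..n}"]) (use that in blast, simp)
  have "card {F. F \<subseteq> all_triangles n \<and> card F = f \<and> card (\<Union>F) = v} \<le> card (\<Union>W\<in>?W. Pow (Pow W))"
  proof (rule card_mono)
    show "finite (\<Union>W\<in>?W. Pow (Pow W))"
      by (rule finite_UN_I[OF finW]) (simp only: finite_Pow_iff fin)
    show "{F. F \<subseteq> all_triangles n \<and> card F = f \<and> card (\<Union>F) = v} \<subseteq> (\<Union>W\<in>?W. Pow (Pow W))"
    proof
      fix F assume F: "F \<in> {F. F \<subseteq> all_triangles n \<and> card F = f \<and> card (\<Union>F) = v}"
      then have "\<Union>F \<in> ?W" unfolding all_triangles_def by blast
      moreover have "F \<in> Pow (Pow (\<Union>F))" by blast
      ultimately show "F \<in> (\<Union>W\<in>?W. Pow (Pow W))" by blast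
    qed
  qed
  also have "\<dots> \<le> (\<Sum>W\<in>?W. card (Pow (Pow W)))" by (rule card_UN_le[OF finW])
  also have "\<dots> = (n choose v) * 2 ^ (2 ^ v)"
  proof -
    have "card (Pow (Pow W)) = 2 ^ (2 ^ v)" if W: "W \<in> ?W" for W
      using fin[OF W] W by (simp add: card_Pow)
    then have "(\<Sum>W\<in>?W. card (Pow (Pow W))) = (\<Sum>W\<in>?W. 2 ^ (2 ^ v))" by (rule sum.cong[OF refl])
    then show ?thesis using n_subsets[of "{1..n}" v] by simp
  qed
  also have "\<dots> \<le> n ^ v * 2 ^ (2 ^ v)"
    using binomial_le_pow[of v n] by (cases "v \<le> n") (auto simp: binomial_eq_0)
  finally show ?thesis by (simp add: mult.commute)
qed

lemma prob_contains_type_le: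
  assumes p: "0 \<le> p" "p \<le> 1"
  shows "measure_pmf.prob (linial_meshulam n p) {Y. contains_type f v Y}
    \<le> 2 ^ (2 ^ v) * real n ^ v * p ^ f"
proof -
  let ?M = "linial_meshulam n p"
  let ?I = "{F. F \<subseteq> all_triangles n \<and> card F = f \<and> card (\<Union>F) = v}"
  have finI: "finite ?I"
    by (rule finite_subset[of _ "Pow (all_triangles n)"]) (auto simp: finite_all_triangles)
  have "measure_pmf.prob ?M {Y. contains_type f v Y}
      \<le> measure_pmf.prob ?M (\<Union>F\<in>?I. {Y. F \<subseteq> triangles Y})"
  \<comment> \<open>The inclusion holds only on the support, where all triangles have vertices in
    \<open>{1..n}\<close>.\<close>
  proof (rule measure_pmf.finite_measure_mono_AE)
    show "AE Y in ?M. Y \<in> {Y. contains_type f v Y} \<longrightarrow> Y \<in> (\<Union>F\<in>?I. {Y. F \<subseteq> triangles Y})"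
    proof (rule AE_pmfI, rule impI)
      fix Y assume "Y \<in> set_pmf ?M" and c: "Y \<in> {Y. contains_type f v Y}"
      then obtain g where "Y = lm_complex n g" using set_linial_meshulam by blast
      then have "triangles Y \<subseteq> all_triangles n" by (auto simp: triangles_lm_complex)
      then show "Y \<in> (\<Union>F\<in>?I. {Y. F \<subseteq> triangles Y})" using c by (auto simp: contains_type_def)
    qed
  qed simp
  also have "\<dots> \<le> (\<Sum>F\<in>?I. measure_pmf.prob ?M {Y. F \<subseteq> triangles Y})"
    by (rule measure_pmf.finite_measure_subadditive_finite[OF finI]) auto
  also have "\<dots> = real (card ?I) * p ^ f" using prob_superset[OF p] by simp
  also have "\<dots> \<le> real (2 ^ (2 ^ v) * n ^ v) * p ^ f"
    using card_type_le p by (intro mult_right_mono of_nat_mono) auto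
  finally show ?thesis by simp
qed

lemma powr_density_bounds:
  assumes "0 < \<eta>" "n \<ge> 1"
  shows "0 \<le> real n powr (- 1 - \<eta>)" "real n powr (- 1 - \<eta>) \<le> 1"
  using assms powr_mono[of "- 1 - \<eta>" 0 "real n"] by auto

text \<open>The expected count is at most a constant times \<open>n\<close> to the power
  \<open>v - f * (1 + \<eta>)\<close>, which is negative.\<close>

lemma contains_type_tendsto_0:
  assumes "0 < \<eta>" and v: "real v < real f * (1 + \<eta>)"
  shows "(\<lambda>n. measure_pmf.prob (linial_meshulam n (real n powr (- 1 - \<eta>)))
    {Y. contains_type f v Y}) \<longlonglongrightarrow> 0"
proof (rule tendsto_sandwich[OF _ _ tendsto_const])
  show "\<forall>\<^sub>F n in sequentially. measure_pmf.prob (linial_meshulam n (real n powr (- 1 - \<eta>)))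
      {Y. contains_type f v Y} \<le> 2 ^ (2 ^ v) * real n powr (real v - real f * (1 + \<eta>))"
    using eventually_ge_at_top[of 1]
  proof eventually_elim
    case (elim n)
    have "real n ^ v * (real n powr (- 1 - \<eta>)) ^ f = real n powr (real v - real f * (1 + \<eta>))"
      using elim by (simp add: powr_realpow[symmetric] powr_powr powr_add[symmetric] algebra_simps)
    then show ?case
      using prob_contains_type_le[OF powr_density_bounds[OF assms(1) elim], of n f v]
      by (simp add: mult.assoc)
  qed
  have "((\<lambda>x. x powr (real v - real f * (1 + \<eta>))) \<longlongrightarrow> 0) at_top"
    by (rule tendsto_neg_powr[OF _ filterlim_ident]) (use v in simp)
  from filterlim_compose[OF this filterlim_real_sequentially]
  have "(\<lambda>n. real n powr (real v - real f * (1 + \<eta>))) \<longlonglongrightarrow> 0" .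
  from tendsto_mult_right_zero[OF this]
  show "(\<lambda>n. 2 ^ (2 ^ v) * real n powr (real v - real f * (1 + \<eta>))) \<longlonglongrightarrow> 0" .
qed simp

text \<open>The expected number of triangles is at least \<open>n powr (2 - \<eta>) / 27\<close>,
  from the bound \<open>(n/3)^3\<close> on the binomial coefficient, and it diverges since \<eta> is
  below 2.\<close>

lemma no_triangles_tendsto_0:
  assumes "0 < \<eta>" "\<eta> < 2"
  shows "(\<lambda>n. measure_pmf.prob (linial_meshulam n (real n powr (- 1 - \<eta>)))
    {Y. triangles Y = {}}) \<longlonglongrightarrow> 0"
proof (rule tendsto_sandwich[OF _ _ tendsto_const])
  show "\<forall>\<^sub>F n in sequentially. measure_pmf.prob (linial_meshulam n (real n powr (- 1 - \<eta>)))
      {Y. triangles Y = {}} \<le> exp (- (real n powr (2 - \<eta>) / 27))"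
    using eventually_ge_at_top[of 3]
  proof eventually_elim
    case (elim n)
    define p where "p = real n powr (- 1 - \<eta>)"
    have p: "0 \<le> p" "p \<le> 1" using powr_density_bounds[OF assms(1), of n] elim by (auto simp: p_def)
    have "1 - p \<le> exp (- p)" using exp_ge_add_one_self[of "- p"] by simp
    then have "(1 - p) ^ (n choose 3) \<le> exp (- p) ^ (n choose 3)"
      using p by (intro power_mono) auto
    also have "\<dots> = exp (- (real (n choose 3) * p))"
      by (simp flip: exp_of_nat_mult)
    also have "\<dots> \<le> exp (- (real n powr (2 - \<eta>) / 27))"
    proof -
      have "real n powr (3 + (- 1 - \<eta>)) = real n ^ 3 * p"
        unfolding p_def powr_add by simp
      then have "real n powr (2 - \<eta>) = real n ^ 3 * p" by (simp add: algebra_simps)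
      moreover have "(real n / real 3) ^ 3 \<le> real (n choose 3)"
        using binomial_ge_n_over_k_pow_k[of 3 n, where 'a = real] elim by simp
      then have "(real n / 3) ^ 3 * p \<le> real (n choose 3) * p"
        using p by (intro mult_right_mono) simp_all
      ultimately have "real n powr (2 - \<eta>) / 27 \<le> real (n choose 3) * p"
        by (simp only: power_divide times_divide_eq_left) simp
      then show ?thesis by (simp only: exp_le_cancel_iff neg_le_iff_le)
    qed
    finally show ?case using prob_no_triangles[OF p] by (simp add: p_def)
  qed
  have "filterlim (\<lambda>x. exp ((2 - \<eta>) * ln x)) at_top at_top"
    by (rule filterlim_compose[OF exp_at_top
          filterlim_tendsto_pos_mult_at_top[OF tendsto_const _ ln_at_top]]) (use assms in simp)
  moreover have "\<forall>\<^sub>F x in at_top. x powr (2 - \<eta>) = exp ((2 - \<eta>) * ln x)"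
    using eventually_gt_at_top[of 0] by eventually_elim (simp add: powr_def)
  ultimately have "filterlim (\<lambda>x. x powr (2 - \<eta>)) at_top at_top"
    by (simp cong: filterlim_cong)
  from filterlim_compose[OF this filterlim_real_sequentially]
  have "filterlim (\<lambda>n. (1 / 27) * (real n powr (2 - \<eta>))) at_top sequentially"
    by (intro filterlim_tendsto_pos_mult_at_top[OF tendsto_const]) auto
  then have "filterlim (\<lambda>n. - (real n powr (2 - \<eta>) / 27)) at_bot sequentially"
    by (simp add: filterlim_uminus_at_top)
  from filterlim_compose[OF exp_at_bot this]
  show "(\<lambda>n. exp (- (real n powr (2 - \<eta>) / 27))) \<longlonglongrightarrow> 0" .
qed simp

section \<open>Asymptotic bounds for the random complex\<close>

theorem theorem1p4:
  fixes \<eta> :: real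
  assumes "0 < \<eta>" and "\<eta> < 2"
  shows "(\<lambda>n. measure_pmf.prob (linial_meshulam n (real n powr (- 1 - \<eta>)))
            {Y. ereal (\<eta> / 2) \<le> h1 Y \<and> h1 Y \<le> ereal (9 * \<eta> / 4 + 3)}) \<longlonglongrightarrow> 1"
proof -
  \<comment> \<open>The least integer above \<open>2 / \<eta>\<close>, so that
    \<open>M * \<eta> > 2\<close> and even \<open>M + 2\<close> vertices are too few for
    \<open>M\<close> triangles.\<close>
  define M where "M = nat \<lfloor>2 / \<eta>\<rfloor> + 1"
  \<comment> \<open>Finitely many types, each with vanishing probability, so their union is
    negligible.\<close>
  define I where "I = {(f, v). f \<le> M \<and> v \<le> M + 2 \<and> real v < real f * (1 + \<eta>)}"
  define P where "P = (\<lambda>n. measure_pmf.prob (linial_meshulam n (real n powr (- 1 - \<eta>))))"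
  define G where "G = {Y :: nat set set. ereal (\<eta> / 2) \<le> h1 Y \<and> h1 Y \<le> ereal (9 * \<eta> / 4 + 3)}"
  define B where "B = (\<Union>i\<in>I. {Y :: nat set set. contains_type (fst i) (snd i) Y}) \<union> {Y. triangles Y = {}}"
  have finI: "finite I"
    by (rule finite_subset[of _ "{..M} \<times> {..M + 2}"]) (auto simp: I_def)
  have M_gt: "2 / \<eta> < real M" and M_le: "real M \<le> 2 / \<eta> + 1"
    using divide_nonneg_pos[of 2 \<eta>] assms(1) unfolding M_def by linarith+
  have good: "Y \<in> G" if Y: "two_complex Y" and YB: "Y \<notin> B" for Y
  proof -
    interpret two_complex Y by fact
    have no: "(card F, card (\<Union>F)) \<notin> I" if "F \<subseteq> triangles Y" for F
    proof
      assume "(card F, card (\<Union>F)) \<in> I"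
      moreover have "contains_type (card F) (card (\<Union>F)) Y"
        using that unfolding contains_type_def by blast
      ultimately show False using YB unfolding B_def by fastforce
    qed
    have "ereal (1 / (2 / \<eta>)) \<le> h1 Y"
    proof (rule h1_ge)
      fix F assume F: "F \<subseteq> triangles Y" "edge_connected F"
      note finF = edge_connected_finite[OF F(2)]
      have "card F < M"
      proof (rule ccontr)
        assume "\<not> card F < M"
        \<comment> \<open>Cutting down to exactly \<open>M\<close> triangles yields a type in
          \<open>I\<close>.\<close>
        then obtain F' where F': "F' \<subseteq> F" "edge_connected F'" "card F' = M"
          using edge_connected_subset[OF F(2), of M] by (auto simp: M_def)
        have "real M + 2 < real M * (1 + \<eta>)"
          using M_gt assms(1) by (simp add: field_simps)
        moreover have "card (\<Union>F') \<le> M + 2" using edge_connected_card[OF F'(2)] F'(3) by simp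
        ultimately have "(card F', card (\<Union>F')) \<in> I" using F'(3) by (simp add: I_def)
        then show False using no F' F by blast
      qed
      moreover have "card F < card (\<Union>F)"
      proof (rule ccontr)
        assume *: "\<not> card F < card (\<Union>F)"
        \<comment> \<open>With no more vertices than triangles, any positive \<eta> makes the
          exponent negative.\<close>
        have "0 < real (card F) * \<eta>" using finF assms(1) by (simp add: card_gt_0_iff)
        then have "real (card (\<Union>F)) < real (card F) * (1 + \<eta>)"
          using * by (simp add: algebra_simps)
        then have "(card F, card (\<Union>F)) \<in> I" using * \<open>card F < M\<close> by (simp add: I_def)
        then show False using no F by blast
      qed
      \<comment> \<open>Strictness matters: \<open>card F\<close> is at most \<open>M - 1\<close>,
        hence at most \<open>2 / \<eta>\<close>.\<close>
      ultimately show "real (card F) \<le> 2 / \<eta> \<and> card F < card (\<Union>F)" using M_le by linarith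
    qed (use assms in simp)
    \<comment> \<open>The constant bound 3 is stronger than the stated upper bound, because \<eta>
      is positive.\<close>
    moreover have "h1 Y \<le> ereal 3" using h1_le_3 YB by (simp add: B_def)
    moreover have "ereal 3 \<le> ereal (9 * \<eta> / 4 + 3)" using assms(1) by simp
    ultimately show ?thesis by (auto simp: G_def intro: order_trans)
  qed
  have bad: "P n (- G) \<le> (\<Sum>(f, v)\<in>I. P n {Y. contains_type f v Y}) + P n {Y. triangles Y = {}}" for n
  proof -
    let ?U = "\<Union>i\<in>I. {Y :: nat set set. contains_type (fst i) (snd i) Y}"
    have "P n (- G) \<le> P n (?U \<union> {Y. triangles Y = {}})"
      unfolding P_def
    proof (rule measure_pmf.finite_measure_mono_AE)
      show "AE Y in linial_meshulam n (real n powr (- 1 - \<eta>)).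
          Y \<in> - G \<longrightarrow> Y \<in> ?U \<union> {Y. triangles Y = {}}"
      proof (rule AE_pmfI, rule impI)
        fix Y assume "Y \<in> set_pmf (linial_meshulam n (real n powr (- 1 - \<eta>)))" and "Y \<in> - G"
        then have "Y \<in> B" using good two_complex_lm_complex set_linial_meshulam by blast
        then show "Y \<in> ?U \<union> {Y. triangles Y = {}}" by (simp only: B_def)
      qed
    qed simp
    also have "\<dots> \<le> P n ?U + P n {Y. triangles Y = {}}"
      unfolding P_def by (rule measure_Un_le) auto
    also have "P n ?U \<le> (\<Sum>i\<in>I. P n {Y. contains_type (fst i) (snd i) Y})"
      unfolding P_def by (rule measure_pmf.finite_measure_subadditive_finite[OF finI]) auto
    finally show ?thesis by (simp add: case_prod_beta)
  qed
  have "(\<lambda>n. (\<Sum>(f, v)\<in>I. P n {Y. contains_type f v Y}) + P n {Y. triangles Y = {}})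
      \<longlonglongrightarrow> (\<Sum>(f, v)\<in>I. 0) + 0"
    unfolding P_def case_prod_beta
    using contains_type_tendsto_0[OF assms(1)] no_triangles_tendsto_0[OF assms]
    by (intro tendsto_add tendsto_sum) (auto simp: I_def)
  then have "(\<lambda>n. 1 - ((\<Sum>(f, v)\<in>I. P n {Y. contains_type f v Y}) + P n {Y. triangles Y = {}}))
      \<longlonglongrightarrow> 1 - 0"
    by (intro tendsto_diff tendsto_const) simp
  then have lim: "(\<lambda>n. 1 - ((\<Sum>(f, v)\<in>I. P n {Y. contains_type f v Y}) + P n {Y. triangles Y = {}}))
      \<longlonglongrightarrow> 1"
    by simp
  have "(\<lambda>n. P n G) \<longlonglongrightarrow> 1"
  proof (rule tendsto_sandwich[OF _ _ lim tendsto_const])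
    have compl: "P n G = 1 - P n (- G)" for n
      unfolding P_def using measure_pmf.prob_compl[of G] by (simp add: Compl_eq_Diff_UNIV)
    have "1 - ((\<Sum>(f, v)\<in>I. P n {Y. contains_type f v Y}) + P n {Y. triangles Y = {}})
        \<le> P n G" for n
      using bad[of n] compl[of n] by linarith
    then show "\<forall>\<^sub>F n in sequentially.
        1 - ((\<Sum>(f, v)\<in>I. P n {Y. contains_type f v Y}) + P n {Y. triangles Y = {}}) \<le> P n G"
      by (rule always_eventually[OF allI])
    show "\<forall>\<^sub>F n in sequentially. P n G \<le> 1" by (simp add: P_def)
  qed
  then show ?thesis by (simp add: P_def G_def)
qed

end
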